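(* Let $\mathbb{F}_q$ be a finite field and let $n\ge 3$ be an integer. A coprime tuple $(a_1,\dots,a_n)\in\mathbb{F}_q[t]^n$ is a Smyth tuple (over $K=\mathbb{F}_q(t)$) if and only if $a_1,\dots,a_n$ satisfy the absolute value criteria over $\mathbb{F}_q(t)$.
   Context: A tuple $(a_1,\dots,a_n)\in\mathbb{F}_q[t]^n$ is coprime if $a_1,\dots,a_n$ generate the unit ideal of $\mathbb{F}_q[t]$. Elements $\gamma_1,\dots,\gamma_n\in\overline{K}$ are Galois conjugates over $K$ if they are all roots of the same irreducible polynomial over $K$ (they need not be pairwise distinct); throughout, Galois conjugates are assumed nonzero. A linear Galois relation is a relation $\sum_{i=1}^n a_i\gamma_i=0$ with $a_i\in K$ and $\gamma_1,\dots,\gamma_n\in\overline K$ Galois conjugates over $K$. A tuple $(a_1,\dots,a_n)$ is a Smyth tuple (over $K$) if its coordinates are the coefficients of some linear Galois relation over $K$. The absolute value criteria over a field $K$ for $(a_1,\dots,a_n)\in K^n$ are: (1') for any archimedean absolute value $|\cdot|$ of $K$, $|a_i|\le\sum_{j\ne i}|a_j|$ for all $i$; (2') for any nonarchimedean absolute value $|\cdot|$ of $K$, $|a_i|\le\max_{j\neq i}|a_j|$ for all $i$. (The field $\mathbb{F}_q(t)$ has only nonarchimedean absolute values.) *)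

theory Defs
  imports "HOL-Algebra.Algebraic_Closure_Type"
begin

text \<open>
  An \<open>n\<close>-tuple over \<open>R\<close> is a function \<open>nat \<Rightarrow> R\<close> of which only the values at \<open>0, \<dots>, n - 1\<close>
  matter.  An algebraic closure of a field \<open>'k\<close> is the type \<open>'k alg_closure\<close>, with the embedding
  \<open>to_ac\<close>.
\<close>

definition coprime_tuple :: "nat \<Rightarrow> (nat \<Rightarrow> 'r :: comm_ring_1) \<Rightarrow> bool" where
  "coprime_tuple n a \<longleftrightarrow> {\<Sum>i<n. c i * a i |c. True} = UNIV"

text \<open>Conjugates may repeat, and are nonzero by convention.\<close>

definition galois_conjugates :: "nat \<Rightarrow> (nat \<Rightarrow> 'k :: field alg_closure) \<Rightarrow> bool" where
  "galois_conjugates n \<gamma> \<longleftrightarrow>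
     (\<exists>p :: 'k poly. Factorial_Ring.irreducible p \<and>
        (\<forall>i<n. Polynomial.poly (map_poly to_ac p) (\<gamma> i) = 0 \<and> \<gamma> i \<noteq> 0))"

definition smyth_tuple :: "nat \<Rightarrow> (nat \<Rightarrow> 'k :: field) \<Rightarrow> bool" where
  "smyth_tuple n a \<longleftrightarrow>
     (\<exists>\<gamma> :: nat \<Rightarrow> 'k alg_closure. galois_conjugates n \<gamma> \<and> (\<Sum>i<n. to_ac (a i) * \<gamma> i) = 0)"

text \<open>The trivial absolute value is included (as a nonarchimedean one).\<close>

definition absolute_value :: "('k :: field \<Rightarrow> real) \<Rightarrow> bool" where
  "absolute_value v \<longleftrightarrow>
     (\<forall>x. 0 \<le> v x) \<and> (\<forall>x. v x = 0 \<longleftrightarrow> x = 0) \<and>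
     (\<forall>x y. v (x * y) = v x * v y) \<and> (\<forall>x y. v (x + y) \<le> v x + v y)"

definition nonarchimedean :: "('k :: field \<Rightarrow> real) \<Rightarrow> bool" where
  "nonarchimedean v \<longleftrightarrow> absolute_value v \<and> (\<forall>x y. v (x + y) \<le> max (v x) (v y))"

definition archimedean :: "('k :: field \<Rightarrow> real) \<Rightarrow> bool" where
  "archimedean v \<longleftrightarrow> absolute_value v \<and> \<not> nonarchimedean v"

text \<open>The maximum is over a nonempty set, hence meaningful, only for \<open>n \<ge> 2\<close>.\<close>

definition absolute_value_criteria :: "nat \<Rightarrow> (nat \<Rightarrow> 'k :: field) \<Rightarrow> bool" where
  "absolute_value_criteria n a \<longleftrightarrow>
     (\<forall>v. archimedean v \<longrightarrow> (\<forall>i<n. v (a i) \<le> (\<Sum>j\<in>{..<n} - {i}. v (a j)))) \<and>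
     (\<forall>v. nonarchimedean v \<longrightarrow> (\<forall>i<n. v (a i) \<le> (MAX j\<in>{..<n} - {i}. v (a j))))"

end

theory Submission
  imports Defs "HOL-Combinatorics.Permutations"
begin

text \<open>
  Write \<open>K\<close> for \<open>F\<^sub>q(t)\<close>. Galois conjugates are the orbits of the automorphisms of the algebraic closure
  over \<open>K\<close>. That there are enough automorphisms follows from \<open>extend_hom_to_closure\<close>.

  The criteria are necessary: in a relation where some \<open>\<bar>a\<^sub>i\<bar>\<close> is larger than all other \<open>\<bar>a\<^sub>j\<bar>\<close>,
  division by \<open>a\<^sub>i\<close> and application of automorphisms express each root of the irreducible
  polynomial as a combination of roots whose coefficients are all smaller than \<open>1\<close>. A matrix with
  entries smaller than \<open>1\<close> fixes no nonzero vector, so all the roots would be zero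
  (\<open>smyth_tuple_nonarchimedean\<close>). There are no archimedean absolute values in positive characteristic
  (\<open>not_archimedean\<close>).

  For the converse, let \<open>D\<close> be the largest degree of the \<open>a\<^sub>i\<close> and let \<open>V\<close> be the finite group of the
  solutions \<open>x\<close> of \<open>\<Sum>\<^sub>i a\<^sub>i x\<^sub>i = 0\<close> in polynomials of degree at most \<open>D\<close>. By coprimality and the criteria every
  coordinate maps \<open>V\<close> onto all polynomials of degree at most \<open>D\<close>: the finite places yield
  solvability and the place at infinity yields the degree bound. So all coordinates have the same
  distribution on \<open>V\<close> and differ by permutations of \<open>V\<close> (\<open>solutions_of_criteria\<close>). Suppose that
  \<open>r\<^sub>x\<close>, for \<open>x \<in> V\<close>, are distinct elements of the algebraic closure which the automorphisms permute in
  all possible ways. Then the elements \<open>\<gamma>\<^sub>i = \<Sum>\<^sub>x x\<^sub>i r\<^sub>x\<close> satisfy the relation, since it holds for each \<open>x\<close>, and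
  they are conjugate, since the permutations of \<open>V\<close> are induced by automorphisms
  (\<open>smyth_tuple_of_solutions\<close>).

  It remains to find a polynomial over \<open>K\<close> of degree \<open>k = \<bar>V\<bar>\<close> whose \<open>k\<close> roots are permuted in all ways
  (\<open>symmetric_group_realization\<close>). It suffices that for each \<open>j < k\<close> there are \<open>j\<close> roots whose
  pointwise stabilizer is transitive on the other ones
  (\<open>automorphism_extending_injection\<close>). This is a local condition: it holds if over the field of
  Laurent series at some point of the affine line the polynomial is the product of \<open>j\<close> distinct linear factors and an Eisenstein
  polynomial (\<open>transitive_on_remaining_roots\<close>). Using a different point for each \<open>j\<close>, one
  obtains all these factorizations simultaneously (\<open>polynomial_with_good_points\<close>).
\<close>

section \<open>Homomorphisms\<close>

text \<open>
  Subrings of a type and homomorphisms defined on them are needed for intermediate fields of an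
  algebraic closure and for extending embeddings of such fields step by step; total homomorphisms
  are those on \<open>UNIV\<close>.
\<close>

definition subring_set :: "'a :: comm_ring_1 set \<Rightarrow> bool" where
  "subring_set S \<longleftrightarrow> 1 \<in> S \<and> (\<forall>x\<in>S. \<forall>y\<in>S. x - y \<in> S \<and> x * y \<in> S)"

definition hom_on :: "'a :: comm_ring_1 set \<Rightarrow> ('a \<Rightarrow> 'b :: comm_ring_1) \<Rightarrow> bool" where
  "hom_on S h \<longleftrightarrow> h 1 = 1 \<and> (\<forall>x\<in>S. \<forall>y\<in>S. h (x + y) = h x + h y \<and> h (x * y) = h x * h y)"

definition polys_over :: "'a :: zero set \<Rightarrow> 'a poly set" where
  "polys_over S = {p. \<forall>i. coeff p i \<in> S}"

lemma subring_set_UNIV [simp]: "subring_set UNIV"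
  by (simp add: subring_set_def)

lemma subring_setD:
  assumes "subring_set S"
  shows "1 \<in> S" "0 \<in> S" "x \<in> S \<Longrightarrow> - x \<in> S"
    "x \<in> S \<Longrightarrow> y \<in> S \<Longrightarrow> x + y \<in> S" "x \<in> S \<Longrightarrow> y \<in> S \<Longrightarrow> x - y \<in> S"
    "x \<in> S \<Longrightarrow> y \<in> S \<Longrightarrow> x * y \<in> S"
proof -
  show 1: "1 \<in> S" and diff: "x \<in> S \<Longrightarrow> y \<in> S \<Longrightarrow> x - y \<in> S" 
    and "x \<in> S \<Longrightarrow> y \<in> S \<Longrightarrow> x * y \<in> S" for x y
    using assms by (auto simp: subring_set_def)
  show 0: "0 \<in> S" using diff[OF 1 1] by simp
  show minus: "x \<in> S \<Longrightarrow> - x \<in> S" for x using diff[OF 0, of x] by simp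
  show "x \<in> S \<Longrightarrow> y \<in> S \<Longrightarrow> x + y \<in> S" using diff[OF _ minus, of x y] by simp
qed

lemma subring_set_sum: "subring_set S \<Longrightarrow> (\<And>i. i \<in> I \<Longrightarrow> f i \<in> S) \<Longrightarrow> sum f I \<in> S"
  by (induction I rule: infinite_finite_induct) (auto simp: subring_setD)

lemma subring_set_prod: "subring_set S \<Longrightarrow> (\<And>i. i \<in> I \<Longrightarrow> f i \<in> S) \<Longrightarrow> prod f I \<in> S"
  by (induction I rule: infinite_finite_induct) (auto simp: subring_setD)

lemma subring_set_power: "subring_set S \<Longrightarrow> x \<in> S \<Longrightarrow> x ^ n \<in> S"
  by (induction n) (auto simp: subring_setD)

lemma hom_onD:
  assumes "hom_on S h"
  shows "h 1 = 1" "x \<in> S \<Longrightarrow> y \<in> S \<Longrightarrow> h (x + y) = h x + h y"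
    "x \<in> S \<Longrightarrow> y \<in> S \<Longrightarrow> h (x * y) = h x * h y"
  using assms by (auto simp: hom_on_def)

lemma hom_on_0: "subring_set S \<Longrightarrow> hom_on S h \<Longrightarrow> h 0 = 0"
  using hom_onD(2)[of S h 0 0] by (simp add: subring_setD)

lemma hom_on_uminus: "subring_set S \<Longrightarrow> hom_on S h \<Longrightarrow> x \<in> S \<Longrightarrow> h (- x) = - h x"
  using hom_onD(2)[of S h x "- x"] hom_on_0[of S h] by (simp add: subring_setD add_eq_0_iff)

lemma hom_on_diff: "subring_set S \<Longrightarrow> hom_on S h \<Longrightarrow> x \<in> S \<Longrightarrow> y \<in> S \<Longrightarrow> h (x - y) = h x - h y"
  using hom_onD(2)[of S h x "- y"] hom_on_uminus[of S h y] by (simp add: subring_setD)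

lemma hom_on_sum:
  "subring_set S \<Longrightarrow> hom_on S h \<Longrightarrow> (\<And>i. i \<in> I \<Longrightarrow> f i \<in> S) \<Longrightarrow> h (sum f I) = (\<Sum>i\<in>I. h (f i))"
  by (induction I rule: infinite_finite_induct) (auto simp: hom_on_0 hom_onD subring_set_sum)

lemma hom_on_prod:
  "subring_set S \<Longrightarrow> hom_on S h \<Longrightarrow> (\<And>i. i \<in> I \<Longrightarrow> f i \<in> S) \<Longrightarrow> h (prod f I) = (\<Prod>i\<in>I. h (f i))"
  by (induction I rule: infinite_finite_induct) (auto simp: hom_onD subring_set_prod)

lemma hom_on_power: "subring_set S \<Longrightarrow> hom_on S h \<Longrightarrow> x \<in> S \<Longrightarrow> h (x ^ n) = h x ^ n"
  by (induction n) (auto simp: hom_onD subring_set_power)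

lemma hom_on_compose: "hom_on S g \<Longrightarrow> g ` S \<subseteq> T \<Longrightarrow> hom_on T h \<Longrightarrow> hom_on S (h \<circ> g)"
  unfolding hom_on_def by (auto simp: image_subset_iff)

lemma hom_to_ac: "hom_on UNIV to_ac"
  by (simp add: hom_on_def)

lemma hom_to_fract: "hom_on UNIV to_fract"
  by (simp add: hom_on_def to_fract_def One_fract_def)

text \<open>The relation \<open>x \<cdot> x\<^sup>-\<^sup>1 = 1\<close> is preserved, provided that it can be stated within \<open>S\<close>.\<close>

lemma hom_on_nonzero:
  fixes h :: "'a :: field \<Rightarrow> 'b :: field"
  assumes "subring_set S" "hom_on S h" "x \<in> S" "inverse x \<in> S" "x \<noteq> 0"
  shows "h x \<noteq> 0"
  using hom_onD(3)[OF assms(2,3,4)] hom_onD(1)[OF assms(2)] assms(5) by auto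

lemma hom_inj:
  fixes h :: "'a :: field \<Rightarrow> 'b :: field"
  assumes "hom_on UNIV h"
  shows "inj h"
proof (rule injI)
  fix x y assume "h x = h y"
  hence "h (x - y) = 0" using hom_on_diff[OF _ assms] by simp
  thus "x = y" using hom_on_nonzero[OF _ assms, of "x - y"] by auto
qed

lemma polys_over_UNIV [simp]: "polys_over UNIV = UNIV"
  by (simp add: polys_over_def)

lemma polys_over_add: "subring_set S \<Longrightarrow> p \<in> polys_over S \<Longrightarrow> q \<in> polys_over S \<Longrightarrow> p + q \<in> polys_over S"
  and polys_over_diff: "subring_set S \<Longrightarrow> p \<in> polys_over S \<Longrightarrow> q \<in> polys_over S \<Longrightarrow> p - q \<in> polys_over S"
  and polys_over_monom: "subring_set S \<Longrightarrow> c \<in> S \<Longrightarrow> monom c n \<in> polys_over S"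
  by (auto simp: polys_over_def subring_setD coeff_monom)

lemma polys_over_pCons_iff: "pCons c p \<in> polys_over S \<longleftrightarrow> c \<in> S \<and> p \<in> polys_over S"
  by (auto simp: polys_over_def coeff_pCons split: nat.splits)

lemma polys_over_mult: "subring_set S \<Longrightarrow> p \<in> polys_over S \<Longrightarrow> q \<in> polys_over S \<Longrightarrow> p * q \<in> polys_over S"
  by (auto simp: polys_over_def coeff_mult intro!: subring_set_sum subring_setD)

lemma subring_polys_over: "subring_set S \<Longrightarrow> subring_set (polys_over S)"
  using polys_over_mult[of S] polys_over_diff[of S] polys_over_monom[of S 1 0]
  unfolding subring_set_def[of "polys_over S"] by (auto simp: subring_setD)

lemma poly_in_subring:
  assumes "subring_set S" "p \<in> polys_over S" "x \<in> S"
  shows "poly p x \<in> S"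
  using assms(2) by (induction p) (auto simp: polys_over_pCons_iff assms subring_setD)

lemma hom_map_poly:
  assumes S: "subring_set S" and h: "hom_on S h"
  shows "hom_on (polys_over S) (map_poly h)"
proof -
  note h0 = hom_on_0[OF S h]
  have "map_poly h (p * q) = map_poly h p * map_poly h q"
    if "p \<in> polys_over S" "q \<in> polys_over S" for p q
  proof (rule poly_eqI)
    fix n
    have "coeff (map_poly h (p * q)) n = (\<Sum>i\<le>n. h (coeff p i * coeff q (n - i)))"
      using that hom_on_sum[OF S h, of "{..n}" "\<lambda>i. coeff p i * coeff q (n - i)"]
      by (simp add: coeff_map_poly h0 coeff_mult polys_over_def subring_setD[OF S])
    also have "\<dots> = coeff (map_poly h p * map_poly h q) n"
      using that hom_onD[OF h] by (simp add: coeff_map_poly h0 coeff_mult polys_over_def)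
    finally show "coeff (map_poly h (p * q)) n = coeff (map_poly h p * map_poly h q) n" .
  qed
  moreover have "map_poly h (p + q) = map_poly h p + map_poly h q"
    if "p \<in> polys_over S" "q \<in> polys_over S" for p q
    by (rule poly_eqI) (use that hom_onD[OF h] in \<open>auto simp: coeff_map_poly h0 polys_over_def\<close>)
  moreover have "map_poly h 1 = 1"
    by (rule poly_eqI) (auto simp: coeff_map_poly h0 coeff_1 hom_onD[OF h])
  ultimately show ?thesis by (auto simp: hom_on_def)
qed

lemma poly_map_poly_hom:
  assumes S: "subring_set S" and h: "hom_on S h" and "p \<in> polys_over S" "x \<in> S"
  shows "poly (map_poly h p) (h x) = h (poly p x)"
  using assms(3)
proof (induction p)
  case (pCons a p)
  thus ?case using assms(4) hom_onD[OF h] poly_in_subring[OF S, of p x] subring_setD[OF S]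
    by (cases "p = 0 \<and> a = 0") (auto simp: map_poly_pCons hom_on_0[OF S h] polys_over_pCons_iff)
qed (auto simp: hom_on_0[OF S h])

lemma map_poly_hom_UNIV: "hom_on UNIV h \<Longrightarrow> hom_on UNIV (map_poly h)"
  using hom_map_poly[of UNIV h] by simp

section \<open>Extending homomorphisms\<close>

text \<open>
  A polynomial relation \<open>a + x y = 0\<close> with a constant \<open>a \<noteq> 0\<close> exhibits \<open>- y / a\<close> as the inverse of
  \<open>x\<close>. Hence every ring between a field and its algebraic closure is a field, and it suffices to
  keep track of subrings below.
\<close>

lemma inverse_in_intermediate_ring:
  fixes S :: "'k :: field alg_closure set"
  assumes S: "subring_set S" "range to_ac \<subseteq> S" and x: "x \<in> S"
  shows "inverse x \<in> S"
proof (cases "x = 0")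
  case False
  have "inverse x \<in> S" if "p \<noteq> 0" "poly (map_poly to_ac p) x = 0" for p :: "'k poly"
    using that
  proof (induction p)
    case (pCons a p)
    let ?y = "poly (map_poly to_ac p) x"
    have y: "?y \<in> S"
      using S x by (intro poly_in_subring) (auto simp: polys_over_def coeff_map_poly)
    have eq: "to_ac a + x * ?y = 0"
      using pCons by (simp add: map_poly_pCons)
    show ?case
    proof (cases "a = 0")
      case True
      thus ?thesis using pCons eq False by auto
    next
      case a: False
      have "x * (- ?y * to_ac (inverse a)) = 1"
      proof -
        have "x * (- ?y) = to_ac a"
          using eq by (metis add.inverse_inverse eq_neg_iff_add_eq_0 mult_minus_right)
        hence "x * (- ?y * to_ac (inverse a)) = to_ac a * to_ac (inverse a)"
          by (metis mult.assoc)
        thus ?thesis using a by simp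
      qed
      hence "inverse x = - ?y * to_ac (inverse a)" by (metis inverse_unique)
      thus ?thesis using y S by (metis rangeI subring_setD(3,6) subsetD)
    qed
  qed auto
  thus ?thesis using alg_closure_algebraic[of x] by metis
qed (use S in \<open>auto simp: subring_setD\<close>)

lemma polys_over_division:
  fixes S :: "'a :: field set"
  assumes S: "subring_set S" "\<And>x. x \<in> S \<Longrightarrow> inverse x \<in> S"
    and m: "m \<in> polys_over S" "m \<noteq> 0" and "g \<in> polys_over S"
  shows "\<exists>q\<in>polys_over S. \<exists>r\<in>polys_over S. g = m * q + r \<and> (r = 0 \<or> degree r < degree m)"
  using assms(5)
proof (induction "degree g" arbitrary: g rule: less_induct)
  case less
  have S0: "0 \<in> polys_over S" using S by (auto simp: polys_over_def subring_setD)
  show ?case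
  proof (cases "g = 0 \<or> degree g < degree m")
    case True
    thus ?thesis using less.prems S0 by (intro bexI[of _ 0] bexI[of _ g]) auto
  next
    case False
    define c where "c = lead_coeff g * inverse (lead_coeff m)"
    define u where "u = monom c (degree g - degree m)"
    define g' where "g' = g - m * u"
    have "lead_coeff g \<in> S" "lead_coeff m \<in> S" using less.prems m by (auto simp: polys_over_def)
    hence u: "u \<in> polys_over S"
      unfolding u_def c_def by (intro polys_over_monom S subring_setD)
    have g': "g' \<in> polys_over S"
      unfolding g'_def by (intro polys_over_diff polys_over_mult S m u less.prems)
    have "c \<noteq> 0" using False m by (auto simp: c_def)
    hence "degree u = degree g - degree m" "u \<noteq> 0"
      by (simp_all add: u_def degree_monom_eq monom_eq_0_iff)
    hence deg: "degree (m * u) = degree g"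
      using False m by (simp add: degree_mult_eq)
    have "lead_coeff (m * u) = lead_coeff g"
    proof -
      have "lead_coeff u = c" unfolding u_def by (rule lead_coeff_monom)
      thus ?thesis using m by (simp add: lead_coeff_mult c_def)
    qed
    hence g'_less: "g' = 0 \<or> degree g' < degree g"
      using deg unfolding g'_def
      by (metis coeff_diff degree_diff_le diff_self le_eq_less_or_eq leading_coeff_0_iff order_refl)
    show ?thesis
    proof (cases "g' = 0")
      case True
      thus ?thesis using u S0 by (intro bexI[of _ u] bexI[of _ 0]) (auto simp: g'_def)
    next
      case False
      then obtain q r where qr: "q \<in> polys_over S" "r \<in> polys_over S" "g' = m * q + r"
        "r = 0 \<or> degree r < degree m"
        using less.hyps[OF _ g'] g'_less by blast
      have "g = m * (q + u) + r" using qr(3) by (simp add: g'_def algebra_simps)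
      thus ?thesis using qr u S by (intro bexI[of _ "q + u"] bexI[of _ r]) (auto intro: polys_over_add)
    qed
  qed
qed

text \<open>
  The minimal polynomial up to a constant factor: a nonzero polynomial over \<open>S\<close> of least degree with
  the root \<open>z\<close>.
\<close>

definition minpoly_over :: "'a :: field set \<Rightarrow> 'a \<Rightarrow> 'a poly \<Rightarrow> bool" where
  "minpoly_over S z m \<longleftrightarrow> m \<in> polys_over S \<and> m \<noteq> 0 \<and> poly m z = 0 \<and>
     (\<forall>g\<in>polys_over S. poly g z = 0 \<longrightarrow> g \<noteq> 0 \<longrightarrow> degree m \<le> degree g)"

lemma minpoly_over_exists:
  fixes S :: "'k :: field alg_closure set"
  assumes "range to_ac \<subseteq> S"
  obtains m where "minpoly_over S z m"
proof -
  obtain p :: "'k poly" where p: "p \<noteq> 0" "poly (map_poly to_ac p) z = 0"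
    by (rule alg_closure_algebraic)
  let ?P = "\<lambda>g. g \<in> polys_over S \<and> g \<noteq> 0 \<and> poly g z = 0"
  have "?P (map_poly to_ac p)"
    using p assms by (auto simp: polys_over_def coeff_map_poly map_poly_eq_0_iff)
  then obtain m where "?P m" "\<forall>g. ?P g \<longrightarrow> degree m \<le> degree g"
    using ex_has_least_nat[of ?P _ degree] by blast
  thus ?thesis by (intro that) (auto simp: minpoly_over_def)
qed

lemma minpoly_over_dvd:
  assumes S: "subring_set S" "\<And>x. x \<in> S \<Longrightarrow> inverse x \<in> S"
    and m: "minpoly_over S z m" and g: "g \<in> polys_over S" "poly g z = 0"
  obtains q where "q \<in> polys_over S" "g = m * q"
proof -
  obtain q r where qr: "q \<in> polys_over S" "r \<in> polys_over S" "g = m * q + r"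
      "r = 0 \<or> degree r < degree m"
    using polys_over_division[OF S _ _ g(1)] m by (metis minpoly_over_def)
  have "poly r z = 0" using g(2) m qr(3) by (simp add: minpoly_over_def)
  hence "r = 0" using qr m by (auto simp: minpoly_over_def)
  thus ?thesis using that qr by simp
qed

text \<open>
  The ring generated by \<open>S\<close> and \<open>z\<close> is the quotient of the polynomial ring over \<open>S\<close> by the minimal
  polynomial of \<open>z\<close>, so \<open>z\<close> may be sent to any root of the image of that polynomial.
\<close>

lemma extend_hom_step:
  fixes S :: "'k :: field alg_closure set" and h :: "'k alg_closure \<Rightarrow> 'b :: field"
  assumes S: "subring_set S" "range to_ac \<subseteq> S" and h: "hom_on S h"
    and m: "minpoly_over S z m" and y: "poly (map_poly h m) y = 0"
  obtains S' h' where "subring_set S'" "S \<subseteq> S'" "z \<in> S'" "hom_on S' h'"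
    "\<And>x. x \<in> S \<Longrightarrow> h' x = h x" "h' z = y"
proof -
  note inv = inverse_in_intermediate_ring[OF S]
  note P = subring_polys_over[OF S(1)]
  note hP = hom_map_poly[OF S(1) h]
  let ?P = "polys_over S"
  define S' where "S' = (\<lambda>g. poly g z) ` ?P"
  define h' where "h' x = poly (map_poly h (SOME g. g \<in> ?P \<and> poly g z = x)) y" for x
  have h'_eq: "h' (poly g z) = poly (map_poly h g) y" if g: "g \<in> ?P" for g
  proof -
    define g' where "g' = (SOME g'. g' \<in> ?P \<and> poly g' z = poly g z)"
    have g': "g' \<in> ?P" "poly g' z = poly g z"
      using someI[of "\<lambda>g'. g' \<in> ?P \<and> poly g' z = poly g z" g] g by (auto simp: g'_def)
    obtain q where q: "q \<in> ?P" "g - g' = m * q"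
      using minpoly_over_dvd[OF S(1) inv m, of "g - g'"] g g' subring_setD[OF P] by auto
    have "map_poly h g - map_poly h g' = map_poly h m * map_poly h q"
      using hom_on_diff[OF P hP g g'(1)] q m hom_onD(3)[OF hP, of m q] by (simp add: minpoly_over_def)
    from arg_cong[OF this, of "\<lambda>p. poly p y"]
    show ?thesis using y by (simp add: h'_def g'_def)
  qed
  have const: "[:x:] \<in> ?P" if "x \<in> S" for x
    using that subring_setD(2)[OF P] by (simp add: polys_over_pCons_iff)
  have X: "[:0,1:] \<in> ?P"
    using subring_setD[OF S(1)] subring_setD(2)[OF P] by (simp add: polys_over_pCons_iff)
  show ?thesis
  proof (rule that)
    show "subring_set S'"
      unfolding subring_set_def S'_def using subring_setD[OF P]
      by (auto simp flip: poly_mult poly_diff intro: image_eqI[of _ _ 1])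
    show "S \<subseteq> S'" unfolding S'_def using const by (auto intro!: image_eqI[of _ _ "[:_:]"])
    show "z \<in> S'" unfolding S'_def using X by (auto intro!: image_eqI[of _ _ "[:0,1:]"])
    show "h' z = y"
      using h'_eq[OF X] by (simp add: map_poly_pCons hom_on_0[OF S(1) h] hom_onD(1)[OF h])
    show "h' x = h x" if "x \<in> S" for x
      using h'_eq[OF const[OF that]] by (simp add: map_poly_pCons hom_on_0[OF S(1) h])
    moreover have "h' (poly p z + poly q z) = h' (poly p z) + h' (poly q z)"
        "h' (poly p z * poly q z) = h' (poly p z) * h' (poly q z)"
      if "p \<in> ?P" "q \<in> ?P" for p q
      using that subring_setD[OF P] hom_onD[OF hP] 
      by (simp_all add: h'_eq flip: poly_add poly_mult)
    ultimately show "hom_on S' h'"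
      using subring_setD(1)[OF S(1)] hom_onD(1)[OF h] by (auto simp: hom_on_def S'_def)
  qed
qed

text \<open>
  By Zorn's lemma there is a maximal extension. Partial homomorphisms are represented by their
  graphs, which are exactly the single-valued subrings of the product ring; so the union of a chain
  of them is one again.
\<close>

theorem extend_hom_to_closure:
  fixes S :: "'k :: field alg_closure set" and h :: "'k alg_closure \<Rightarrow> 'b :: alg_closed_field"
  assumes S: "subring_set S" "range to_ac \<subseteq> S" and h: "hom_on S h"
  obtains H where "hom_on UNIV H" "\<And>x. x \<in> S \<Longrightarrow> H x = h x"
proof -
  define good where "good G \<longleftrightarrow> (\<forall>x\<in>S. (x, h x) \<in> G) \<and>
     (\<forall>x y y'. (x, y) \<in> G \<longrightarrow> (x, y') \<in> G \<longrightarrow> y = y') \<and>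
     (\<forall>x y x' y'. (x, y) \<in> G \<longrightarrow> (x', y') \<in> G \<longrightarrow> (x - x', y - y') \<in> G \<and> (x * x', y * y') \<in> G)" for G
  have "\<exists>G\<in>{G. good G}. \<forall>G'\<in>{G. good G}. G \<subseteq> G' \<longrightarrow> G' = G"
  proof (rule subset_Zorn_nonempty)
    have "good ((\<lambda>x. (x, h x)) ` S)"
      using subring_setD[OF S(1)] hom_on_diff[OF S(1) h] hom_onD(3)[OF h]
      unfolding good_def by (auto intro!: image_eqI)
    thus "{G. good G} \<noteq> {}" by auto
  next
    fix C assume C: "C \<noteq> {}" "subset.chain {G. good G} C"
    have common: "\<exists>G\<in>C. u \<in> G \<and> v \<in> G" if "u \<in> \<Union>C" "v \<in> \<Union>C" for u v
    proof -
      obtain G1 G2 where G: "G1 \<in> C" "u \<in> G1" "G2 \<in> C" "v \<in> G2" using \<open>u \<in> \<Union>C\<close> \<open>v \<in> \<Union>C\<close> by blast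
      hence "G1 \<subseteq> G2 \<or> G2 \<subseteq> G1" using C(2) unfolding subset.chain_def by auto
      thus ?thesis using G by blast
    qed
    have gd: "good G" if "G \<in> C" for G using C(2) that unfolding subset.chain_def by auto
    show "\<Union>C \<in> {G. good G}"
      unfolding mem_Collect_eq good_def
    proof (intro conjI ballI allI impI)
      show "(x, h x) \<in> \<Union>C" if "x \<in> S" for x using C(1) gd that unfolding good_def by blast
      show "y = y'" if "(x, y) \<in> \<Union>C" "(x, y') \<in> \<Union>C" for x y y'
        using common[OF that] gd unfolding good_def by metis
      show "(x - x', y - y') \<in> \<Union>C" "(x * x', y * y') \<in> \<Union>C" 
        if "(x, y) \<in> \<Union>C" "(x', y') \<in> \<Union>C" for x y x' y'
        using common[OF that] gd unfolding good_def by (metis Union_iff)+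
    qed
  qed
  then obtain G where G: "good G" and max: "\<And>G'. good G' \<Longrightarrow> G \<subseteq> G' \<Longrightarrow> G' = G" by blast
  define T where "T = Domain G"
  define H where "H x = (THE y. (x, y) \<in> G)" for x
  have H: "H x = y" if "(x, y) \<in> G" for x y
    using that G unfolding H_def good_def by (metis (mono_tags, lifting) the_equality)
  have H_in: "(x, H x) \<in> G" if "x \<in> T" for x using that H unfolding T_def by auto
  have ST: "S \<subseteq> T" using G unfolding T_def good_def by blast
  have Hh: "H x = h x" if "x \<in> S" for x using G that H unfolding good_def by blast
  have T: "subring_set T"
    unfolding subring_set_def using ST subring_setD(1)[OF S(1)] G
    unfolding T_def good_def by (blast intro: DomainI)
  have Hdiff: "H (x - y) = H x - H y" if "x \<in> T" "y \<in> T" for x y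
    using H_in[OF that(1)] H_in[OF that(2)] G H unfolding good_def by blast
  have Hmult: "H (x * y) = H x * H y" if "x \<in> T" "y \<in> T" for x y
    using H_in[OF that(1)] H_in[OF that(2)] G H unfolding good_def by blast
  have H0: "H 0 = 0" using Hdiff[of 0 0] subring_setD[OF T] by simp
  have Hminus: "H (- y) = - H y" if "y \<in> T" for y
    using Hdiff[of 0 y] subring_setD[OF T] that H0 by simp
  have Hadd: "H (x + y) = H x + H y" if "x \<in> T" "y \<in> T" for x y
    using Hdiff[of x "- y"] subring_setD[OF T] that Hminus by simp
  have homT: "hom_on T H"
    unfolding hom_on_def using Hadd Hmult Hh[of 1] subring_setD(1)[OF S(1)] hom_onD(1)[OF h] by auto
  have "z \<in> T" for z
  proof -
    have T2: "range to_ac \<subseteq> T" using S(2) ST by blast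
    obtain m where m: "minpoly_over T z m" by (rule minpoly_over_exists[OF T2])
    have deg: "degree m > 0"
    proof (rule ccontr)
      assume "\<not> degree m > 0"
      then obtain c where "m = [:c:]" by (auto elim: degree_eq_zeroE)
      thus False using m by (auto simp: minpoly_over_def)
    qed
    have "lead_coeff m \<in> T" "lead_coeff m \<noteq> 0" using m by (auto simp: minpoly_over_def polys_over_def)
    hence "H (lead_coeff m) \<noteq> 0"
      using hom_on_nonzero[OF T homT] inverse_in_intermediate_ring[OF T T2] by blast
    hence "degree (map_poly H m) = degree m"
      by (intro map_poly_degree_eq) auto
    then obtain y where y: "poly (map_poly H m) y = 0"
      using alg_closed_imp_poly_has_root[of "map_poly H m"] deg by auto
    obtain S' h' where S': "subring_set S'" "T \<subseteq> S'" "z \<in> S'" "hom_on S' h'" "\<And>x. x \<in> T \<Longrightarrow> h' x = H x"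
      using extend_hom_step[OF T T2 homT m y] by metis
    let ?G' = "(\<lambda>x. (x, h' x)) ` S'"
    have "good ?G'"
      using subring_setD[OF S'(1)] hom_on_diff[OF S'(1,4)] hom_onD(3)[OF S'(4)] ST S'(2,5) Hh
      unfolding good_def by (auto intro!: image_eqI)
    moreover have "G \<subseteq> ?G'"
    proof
      fix u assume u: "u \<in> G"
      obtain x y where [simp]: "u = (x, y)" by force
      have "x \<in> T" "H x = y" using u H unfolding T_def by auto
      thus "u \<in> ?G'" using S'(2,5) by auto
    qed
    ultimately have "?G' = G" by (rule max)
    thus "z \<in> T" using S'(3) unfolding T_def by blast
  qed
  hence "T = UNIV" by auto
  thus ?thesis using that homT Hh by auto
qed

section \<open>Automorphisms\<close>

text \<open>
  Automorphisms over the base field. Bijectivity is a consequence, since finite root sets are mapped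
  injectively into themselves.
\<close>

definition automorphism :: "('k :: field alg_closure \<Rightarrow> 'k alg_closure) \<Rightarrow> bool" where
  "automorphism \<sigma> \<longleftrightarrow> hom_on UNIV \<sigma> \<and> (\<forall>x. \<sigma> (to_ac x) = to_ac x)"

lemma automorphism_root:
  assumes "automorphism \<sigma>" "poly (map_poly to_ac p) x = 0"
  shows "poly (map_poly to_ac p) (\<sigma> x) = 0"
proof -
  have "map_poly \<sigma> (map_poly to_ac p) = map_poly to_ac p"
    using assms(1) hom_on_0[of UNIV \<sigma>] by (intro poly_eqI) (simp add: coeff_map_poly automorphism_def)
  thus ?thesis
    using poly_map_poly_hom[of UNIV \<sigma> "map_poly to_ac p" x] assms hom_on_0[of UNIV \<sigma>]
    by (simp add: automorphism_def)
qed

lemma automorphism_bij: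
  fixes \<sigma> :: "'k :: field alg_closure \<Rightarrow> 'k alg_closure"
  assumes "automorphism \<sigma>"
  shows "bij \<sigma>"
proof -
  have inj: "inj \<sigma>" using assms hom_inj by (auto simp: automorphism_def)
  have "y \<in> range \<sigma>" for y
  proof -
    obtain p :: "'k poly" where p: "p \<noteq> 0" "poly (map_poly to_ac p) y = 0" by (rule alg_closure_algebraic)
    let ?Z = "{z. poly (map_poly to_ac p) z = 0}"
    have "finite ?Z" using p by (intro poly_roots_finite) (simp add: map_poly_eq_0_iff)
    moreover have "\<sigma> ` ?Z \<subseteq> ?Z" using automorphism_root[OF assms] by auto
    ultimately have "\<sigma> ` ?Z = ?Z" using inj by (meson endo_inj_surj inj_on_subset subset_UNIV)
    thus ?thesis using p by blast
  qed
  thus ?thesis using inj by (auto simp: bij_def)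
qed

lemma automorphism_compose: "automorphism \<sigma> \<Longrightarrow> automorphism \<tau> \<Longrightarrow> automorphism (\<sigma> \<circ> \<tau>)"
  unfolding automorphism_def using hom_on_compose[of UNIV \<tau> UNIV \<sigma>] by auto

lemma automorphism_inv:
  assumes "automorphism \<sigma>"
  shows "automorphism (inv_into UNIV \<sigma>)"
proof -
  note b = automorphism_bij[OF assms]
  have s: "\<sigma> (inv_into UNIV \<sigma> x) = x" for x using b by (simp add: bij_is_surj surj_f_inv_f)
  have i: "inv_into UNIV \<sigma> y = x" if "\<sigma> x = y" for x y using that b by (metis bij_is_inj inv_f_f)
  show ?thesis
    using assms by (auto simp: automorphism_def hom_on_def intro!: i simp: s)
qed

text \<open>
  The roots of a minimal polynomial over an intermediate field are conjugate over this field: move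
  one root to the other by a homomorphism on the generated ring and extend it.
\<close>

theorem automorphism_transitive:
  fixes S :: "'k :: field alg_closure set"
  assumes S: "subring_set S" "range to_ac \<subseteq> S" and m: "minpoly_over S z m" and y: "poly m y = 0"
  obtains \<sigma> where "automorphism \<sigma>" "\<And>x. x \<in> S \<Longrightarrow> \<sigma> x = x" "\<sigma> z = y"
proof -
  have id: "hom_on S (\<lambda>x. x)" by (simp add: hom_on_def)
  have "poly (map_poly (\<lambda>x. x) m) y = 0" using y by simp
  then obtain S' h' where h': "subring_set S'" "S \<subseteq> S'" "z \<in> S'" "hom_on S' h'"
    "\<And>x. x \<in> S \<Longrightarrow> h' x = x" "h' z = y"
    using extend_hom_step[OF S id m] by metis
  then obtain \<sigma> where "hom_on UNIV \<sigma>" "\<And>x. x \<in> S' \<Longrightarrow> \<sigma> x = h' x"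
    using extend_hom_to_closure[OF h'(1) _ h'(4)] S(2) by (metis subset_trans)
  thus ?thesis using h' S(2) by (intro that[of \<sigma>]) (auto simp: automorphism_def subset_iff)
qed

lemma subring_range_to_ac: "subring_set (range to_ac)"
  unfolding subring_set_def by (auto simp flip: to_ac_diff to_ac_mult intro: range_eqI[of _ _ 1])

lemma polys_over_range_to_ac:
  "polys_over (range (to_ac :: 'k :: field \<Rightarrow> _)) = range (map_poly to_ac)"
proof
  show "polys_over (range (to_ac :: 'k \<Rightarrow> _)) \<subseteq> range (map_poly to_ac)"
  proof
    fix p :: "'k alg_closure poly" assume p: "p \<in> polys_over (range to_ac)"
    have "p = map_poly to_ac (map_poly of_ac p)"
      using p by (intro poly_eqI) (auto simp: coeff_map_poly polys_over_def to_ac_of_ac)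
    thus "p \<in> range (map_poly to_ac)" by blast
  qed
qed (auto simp: polys_over_def coeff_map_poly)

lemma degree_map_poly_to_ac [simp]: "degree (map_poly to_ac p) = degree p"
  by (rule degree_map_poly) auto

text \<open>
  An irreducible polynomial is minimal for each of its roots, so that the transitivity of
  automorphisms applies to Galois conjugates.
\<close>

lemma irreducible_minpoly:
  fixes p :: "'k :: field poly"
  assumes p: "irreducible p" and z: "poly (map_poly to_ac p) z = 0"
  shows "minpoly_over (range to_ac) z (map_poly to_ac p)"
proof -
  let ?S = "range (to_ac :: 'k \<Rightarrow> _)"
  obtain m where m: "minpoly_over ?S z m" by (rule minpoly_over_exists[OF order_refl])
  obtain q where q: "q \<in> polys_over ?S" "map_poly to_ac p = m * q"
  proof (rule minpoly_over_dvd[OF subring_range_to_ac _ m _ z])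
    show "inverse x \<in> ?S" if "x \<in> ?S" for x using that by (auto simp flip: to_ac_inverse)
    show "map_poly to_ac p \<in> polys_over ?S" by (simp add: polys_over_range_to_ac)
  qed auto
  obtain m' q' where m': "m = map_poly to_ac m'" and q': "q = map_poly to_ac q'"
    using m q(1) by (auto simp: minpoly_over_def polys_over_range_to_ac)
  have "map_poly to_ac p = map_poly to_ac (m' * q')"
    using q hom_onD(3)[OF map_poly_hom_UNIV[OF hom_to_ac], of m' q'] by (simp add: m' q')
  hence pq: "p = m' * q'"
    by (metis (no_types, lifting) inj_to_ac map_poly_0 of_ac_to_ac poly_eqI coeff_map_poly to_ac_0)
  have "\<not> is_unit m'"
  proof
    assume "is_unit m'"
    then obtain c where "m' = [:c:]" "c \<noteq> 0" by (auto simp: is_unit_poly_iff dvd_field_iff)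
    thus False using m by (auto simp: minpoly_over_def m' map_poly_pCons)
  qed
  hence "is_unit q'" using p pq by (auto dest: irreducibleD)
  moreover have "m' \<noteq> 0" using m by (auto simp: minpoly_over_def m')
  ultimately have "degree p = degree m'" by (auto simp: pq is_unit_poly_iff degree_mult_eq)
  thus ?thesis using m z p unfolding minpoly_over_def
    by (auto simp: m' map_poly_eq_0_iff polys_over_range_to_ac)
qed

lemma irreducible_poly_of:
  fixes z :: "'k :: field alg_closure"
  obtains p :: "'k poly" where "irreducible p" "poly (map_poly to_ac p) z = 0"
proof -
  let ?S = "range (to_ac :: 'k \<Rightarrow> _)"
  obtain m where m: "minpoly_over ?S z m" by (rule minpoly_over_exists[OF order_refl])
  then obtain p where p: "m = map_poly to_ac p"
    by (auto simp: minpoly_over_def polys_over_range_to_ac)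
  have p0: "p \<noteq> 0" using m by (auto simp: p minpoly_over_def)
  have min: "degree p \<le> degree g" if "poly (map_poly to_ac g) z = 0" "g \<noteq> 0" for g
    using m that unfolding minpoly_over_def p 
    by (auto simp: polys_over_range_to_ac map_poly_eq_0_iff)
  have unit: "is_unit b" if "p = a * b" "poly (map_poly to_ac a) z = 0" for a b
  proof -
    have "a \<noteq> 0" "b \<noteq> 0" using p0 that by auto
    hence "degree b = 0" using min[OF that(2)] by (simp add: that(1) degree_mult_eq)
    thus ?thesis using \<open>b \<noteq> 0\<close> by (auto simp: is_unit_poly_iff dvd_field_iff elim!: degree_eq_zeroE)
  qed
  have "irreducible p"
  proof (rule irreducibleI)
    show "p \<noteq> 0" by fact
    show "\<not> is_unit p"
    proof
      assume "is_unit p"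
      then obtain c where "p = [:c:]" "c \<noteq> 0" by (auto simp: is_unit_poly_iff dvd_field_iff)
      thus False using m by (auto simp: minpoly_over_def p map_poly_pCons)
    qed
    fix a b assume ab: "p = a * b"
    have "poly (map_poly to_ac a * map_poly to_ac b) z = 0"
      using m hom_onD(3)[OF map_poly_hom_UNIV[OF hom_to_ac], of a b] by (simp add: minpoly_over_def p ab)
    thus "is_unit a \<or> is_unit b" using unit[of a b] unit[of b a] ab by (auto simp: mult.commute)
  qed
  thus ?thesis using m that by (auto simp: minpoly_over_def p)
qed

section \<open>Absolute values\<close>

lemma absolute_valueD:
  assumes "absolute_value v"
  shows "0 \<le> v x" "v x = 0 \<longleftrightarrow> x = 0" "v (x * y) = v x * v y" "v (x + y) \<le> v x + v y"
    "v 0 = 0" "v 1 = 1" "v (- x) = v x"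
proof -
  show "0 \<le> v x" "v x = 0 \<longleftrightarrow> x = 0" and mult: "v (x * y) = v x * v y" and "v (x + y) \<le> v x + v y"
    for x y using assms by (auto simp: absolute_value_def)
  show "v 0 = 0" using assms by (auto simp: absolute_value_def)
  have one: "v 1 * v 1 = v 1" using mult[of 1 1] by simp
  moreover have "v 1 \<noteq> 0" using assms by (auto simp: absolute_value_def)
  ultimately show "v 1 = 1" by simp
  have "v (- 1) * v (- 1) = 1" using mult[of "- 1" "- 1"] \<open>v 1 = 1\<close> by simp
  moreover have "0 \<le> v (- 1)" using assms by (auto simp: absolute_value_def)
  ultimately have "v (- 1) = 1" by (simp add: square_eq_1_iff)
  thus "v (- x) = v x" using mult[of "- 1" x] by simp
qed

lemma absolute_value_divide:
  assumes "absolute_value v"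
  shows "v (x / y) = v x / v y"
proof (cases "y = 0")
  case False
  have "v (x / y) * v y = v x" using absolute_valueD(3)[OF assms, of "x / y" y] False by simp
  thus ?thesis using False absolute_valueD(2)[OF assms, of y] by (simp add: field_simps)
qed (use absolute_valueD(5)[OF assms] in auto)

lemma absolute_value_power: "absolute_value v \<Longrightarrow> v (x ^ m) = v x ^ m"
  by (induction m) (auto simp: absolute_valueD)

lemma nonarchimedean_sum_less:
  assumes "nonarchimedean v" "0 < r" "\<And>i. i \<in> I \<Longrightarrow> v (f i) < r"
  shows "v (sum f I) < r"
  using assms(3)
proof (induction I rule: infinite_finite_induct)
  case (insert i I)
  hence "max (v (f i)) (v (sum f I)) < r" by auto
  thus ?case using insert assms(1) unfolding nonarchimedean_def
    by (metis le_less_trans sum.insert)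
qed (use assms absolute_valueD(5)[of v] in \<open>auto simp: nonarchimedean_def\<close>)

text \<open>
  In characteristic \<open>p > 0\<close> the map \<open>x \<mapsto> x\<^sup>m\<close> is additive for every power \<open>m\<close> of \<open>p\<close>, so the triangle
  inequality gives \<open>\<bar>x + y\<bar>\<^sup>m \<le> \<bar>x\<bar>\<^sup>m + \<bar>y\<bar>\<^sup>m \<le> 2 max(\<bar>x\<bar>, \<bar>y\<bar>)\<^sup>m\<close>. The \<open>m\<close>-th root of \<open>2\<close> tends to
  \<open>1\<close>, which leaves the ultrametric inequality.
\<close>

lemma not_archimedean:
  fixes v :: "'k :: field \<Rightarrow> real"
  assumes "prime CHAR('k)"
  shows "\<not> archimedean v"
proof
  assume "archimedean v"
  hence v: "absolute_value v" and "\<not> nonarchimedean v" by (auto simp: archimedean_def)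
  then obtain x y where xy: "max (v x) (v y) < v (x + y)"
    unfolding nonarchimedean_def by (meson not_le)
  define M where "M = max (v x) (v y)"
  have "M > 0"
  proof (rule ccontr)
    assume "\<not> M > 0"
    hence "v x = 0" "v y = 0"
      using absolute_valueD(1)[OF v, of x] absolute_valueD(1)[OF v, of y] unfolding M_def by linarith+
    thus False using xy absolute_valueD(2)[OF v, of x] absolute_valueD(2)[OF v, of y] by auto
  qed
  define r where "r = v (x + y) / M"
  have "r > 1" using xy \<open>M > 0\<close> by (simp add: r_def M_def)
  then obtain e where e: "2 < r ^ e" using real_arch_pow by blast
  define m where "m = CHAR('k) ^ e"
  have "e < m" unfolding m_def using prime_gt_1_nat[OF assms] by (intro power_gt_expt) simp
  have "v (x + y) ^ m = v (x ^ m + y ^ m)"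
    using freshmans_dream'[OF assms m_def, of x y] absolute_value_power[OF v] by metis
  also have "\<dots> \<le> v x ^ m + v y ^ m"
    using absolute_valueD(4)[OF v] absolute_value_power[OF v] by metis
  also have "\<dots> \<le> M ^ m + M ^ m"
    using absolute_valueD(1)[OF v] by (intro add_mono power_mono) (auto simp: M_def)
  finally have "r ^ m \<le> 2" using \<open>M > 0\<close> by (simp add: r_def power_divide field_simps)
  moreover have "r ^ e \<le> r ^ m" using \<open>e < m\<close> \<open>r > 1\<close> by (intro power_increasing) auto
  ultimately show False using e by linarith
qed

text \<open>
  A matrix whose entries are all smaller than \<open>1\<close> does not have \<open>1\<close> as an eigenvalue. Eliminating
  one unknown replaces the entries by \<open>b\<^sub>i\<^sub>0 b\<^sub>0\<^sub>j / (1 - b\<^sub>0\<^sub>0) + b\<^sub>i\<^sub>j\<close>, which are again smaller than \<open>1\<close>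
  because \<open>\<bar>1 - b\<^sub>0\<^sub>0\<bar> = 1\<close>.
\<close>

lemma small_matrix_no_fixed_vector:
  fixes v :: "'k :: field \<Rightarrow> real" and y :: "'i \<Rightarrow> 'k alg_closure"
  assumes v: "nonarchimedean v" and "finite I"
    and "\<And>i j. i \<in> I \<Longrightarrow> j \<in> I \<Longrightarrow> v (b i j) < 1"
    and "\<And>i. i \<in> I \<Longrightarrow> y i = (\<Sum>j\<in>I. to_ac (b i j) * y j)"
    and "i \<in> I"
  shows "y i = 0"
  using assms(2-5)
proof (induction I arbitrary: b i rule: finite_induct)
  case (insert o' I)
  note abs = v[unfolded nonarchimedean_def, THEN conjunct1]
  note D = absolute_valueD[OF abs]
  define u where "u = 1 - b o' o'"
  have "1 = v (u + b o' o')" using D by (simp add: u_def)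
  also have "\<dots> \<le> max (v u) (v (b o' o'))" using v by (simp add: nonarchimedean_def)
  finally have vu: "v u \<ge> 1" using insert.prems(1)[of o' o'] by auto
  hence u0: "u \<noteq> 0" using D(5) by auto
  define c where "c j = b o' j / u" for j
  have vc: "v (c j) < 1" if "j \<in> I" for j
    using insert.prems(1)[of o' j] that vu absolute_value_divide[OF abs] by (simp add: c_def)
  have yo: "y o' = (\<Sum>j\<in>I. to_ac (c j) * y j)"
  proof -
    have "y o' = to_ac (b o' o') * y o' + (\<Sum>j\<in>I. to_ac (b o' j) * y j)"
      using insert.prems(2)[of o'] insert.hyps by simp
    hence "to_ac u * y o' = (\<Sum>j\<in>I. to_ac (b o' j) * y j)"
      by (simp add: u_def algebra_simps)
    hence "y o' = (\<Sum>j\<in>I. to_ac (b o' j) * y j) / to_ac u"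
      using u0 by (simp add: field_simps)
    thus ?thesis by (simp add: c_def sum_divide_distrib)
  qed
  have "y i = 0" if "i \<in> I" for i
  proof (rule insert.IH[of "\<lambda>i j. b i o' * c j + b i j"])
    fix i j assume ij: "i \<in> I" "j \<in> I"
    have "v (b i o' * c j) < 1"
      using insert.prems(1)[of i o'] vc[of j] ij D(1)[of "b i o'"] D(1)[of "c j"]
      using mult_left_le[of "v (c j)" "v (b i o')"] by (simp add: D(3))
    moreover have "v (b i j) < 1" using insert.prems(1) ij by auto
    ultimately show "v (b i o' * c j + b i j) < 1"
      using v unfolding nonarchimedean_def by (meson le_less_trans max_less_iff_conj)
  next
    fix i assume i: "i \<in> I"
    have "y i = to_ac (b i o') * y o' + (\<Sum>j\<in>I. to_ac (b i j) * y j)"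
      using insert.prems(2)[of i] insert.hyps i by simp
    also have "\<dots> = (\<Sum>j\<in>I. to_ac (b i o' * c j + b i j) * y j)"
      by (simp add: yo sum_distrib_left sum.distrib distrib_right mult.assoc)
    finally show "y i = (\<Sum>j\<in>I. to_ac (b i o' * c j + b i j) * y j)" .
  qed fact
  moreover from this have "y o' = 0" by (simp add: yo)
  ultimately show ?case using insert.prems(3) by auto
qed auto

text \<open>
  If \<open>\<bar>a\<^sub>i\<bar>\<close> exceeded all other \<open>\<bar>a\<^sub>j\<bar>\<close>, the relation would express \<open>\<gamma>\<^sub>i\<close>, and after applying
  automorphisms every conjugate, as a combination of conjugates with coefficients \<open>- a\<^sub>j / a\<^sub>i\<close> of
  absolute value less than \<open>1\<close>. The vector of all conjugates would be fixed by a small matrix, hence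
  be zero. Working with this vector avoids extending the absolute value to the algebraic closure.
\<close>

theorem smyth_tuple_nonarchimedean:
  fixes a :: "nat \<Rightarrow> 'k :: field"
  assumes smyth: "smyth_tuple n a" and v: "nonarchimedean v" and i: "i < n" and n: "n \<ge> 2"
  shows "v (a i) \<le> (MAX j\<in>{..<n} - {i}. v (a j))"
proof (rule ccontr)
  define J where "J = {..<n} - {i}"
  have "(if i = 0 then 1 else 0) \<in> J" using n i by (auto simp: J_def)
  hence J: "finite J" "J \<noteq> {}" by (auto simp: J_def)
  assume "\<not> v (a i) \<le> (MAX j\<in>{..<n} - {i}. v (a j))"
  hence less: "v (a j) < v (a i)" if "j \<in> J" for j
    using that J by (auto simp: J_def[symmetric] not_le)
  have abs: "absolute_value v" using v by (simp add: nonarchimedean_def)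
  have ai: "a i \<noteq> 0"
    using less J absolute_valueD(1,2)[OF abs] by (metis all_not_in_conv not_less)
  from smyth obtain \<gamma> :: "nat \<Rightarrow> 'k alg_closure" and p where p: "irreducible p"
    and \<gamma>: "\<And>i. i < n \<Longrightarrow> poly (map_poly to_ac p) (\<gamma> i) = 0" "\<And>i. i < n \<Longrightarrow> \<gamma> i \<noteq> 0"
    and rel: "(\<Sum>i<n. to_ac (a i) * \<gamma> i) = 0"
    by (auto simp: smyth_tuple_def galois_conjugates_def)
  define R where "R = {z. poly (map_poly to_ac p) z = 0}"
  have "p \<noteq> 0" using p by auto
  hence R: "finite R" unfolding R_def by (intro poly_roots_finite) (simp add: map_poly_eq_0_iff)
  have "\<exists>\<sigma>. automorphism \<sigma> \<and> \<sigma> (\<gamma> i) = \<rho>" if "\<rho> \<in> R" for \<rho>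
    using automorphism_transitive[OF subring_range_to_ac order_refl irreducible_minpoly[OF p \<gamma>(1)[OF i]]] that
    unfolding R_def by blast
  then obtain \<sigma> where \<sigma>: "\<And>\<rho>. \<rho> \<in> R \<Longrightarrow> automorphism (\<sigma> \<rho>)" "\<And>\<rho>. \<rho> \<in> R \<Longrightarrow> \<sigma> \<rho> (\<gamma> i) = \<rho>" by metis
  define b where "b \<rho> \<rho>' = (\<Sum>j\<in>{j\<in>J. \<sigma> \<rho> (\<gamma> j) = \<rho>'}. - a j / a i)" for \<rho> \<rho>'
  have "\<gamma> i = 0"
  proof (rule small_matrix_no_fixed_vector[OF v R, of b "\<lambda>\<rho>. \<rho>"])
    show "v (b \<rho> \<rho>') < 1" for \<rho> \<rho>'
      unfolding b_def
    proof (rule nonarchimedean_sum_less[OF v])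
      fix j assume "j \<in> {j \<in> J. \<sigma> \<rho> (\<gamma> j) = \<rho>'}"
      hence "v (a j) < v (a i)" using less by blast
      thus "v (- a j / a i) < 1"
        using absolute_valueD(1)[OF abs, of "a j"]
        by (simp add: absolute_value_divide[OF abs] absolute_valueD(7)[OF abs])
    qed simp
  next
    fix \<rho> assume \<rho>: "\<rho> \<in> R"
    have hom: "hom_on UNIV (\<sigma> \<rho>)" "\<And>x. \<sigma> \<rho> (to_ac x) = to_ac x"
      using \<sigma>(1)[OF \<rho>] by (auto simp: automorphism_def)
    have "(\<Sum>j<n. to_ac (a j) * \<sigma> \<rho> (\<gamma> j)) = \<sigma> \<rho> (\<Sum>j<n. to_ac (a j) * \<gamma> j)"
      using hom_on_sum[OF subring_set_UNIV hom(1), of "{..<n}" "\<lambda>j. to_ac (a j) * \<gamma> j"] hom(2)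
      by (simp add: hom_onD(3)[OF hom(1)])
    also have "\<dots> = 0" using rel hom_on_0[OF subring_set_UNIV hom(1)] by simp
    finally have "to_ac (a i) * \<rho> + (\<Sum>j\<in>J. to_ac (a j) * \<sigma> \<rho> (\<gamma> j)) = 0"
      using i \<sigma>(2)[OF \<rho>] by (subst (asm) sum.remove[of _ i]) (auto simp: J_def)
    hence "\<rho> = - (\<Sum>j\<in>J. to_ac (a j) * \<sigma> \<rho> (\<gamma> j)) / to_ac (a i)"
      using ai by (simp add: field_simps eq_neg_iff_add_eq_0)
    also have "\<dots> = (\<Sum>j\<in>J. to_ac (- a j / a i) * \<sigma> \<rho> (\<gamma> j))"
      by (simp add: sum_divide_distrib sum_negf)
    also have "\<dots> = (\<Sum>\<rho>'\<in>R. \<Sum>j\<in>{j\<in>J. \<sigma> \<rho> (\<gamma> j) = \<rho>'}. to_ac (- a j / a i) * \<sigma> \<rho> (\<gamma> j))"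
      using automorphism_root[OF \<sigma>(1)[OF \<rho>]] \<gamma>(1)
      by (intro sum.group[symmetric] J R) (auto simp: R_def J_def)
    also have "\<dots> = (\<Sum>\<rho>'\<in>R. to_ac (b \<rho> \<rho>') * \<rho>')"
      by (intro sum.cong) (auto simp: b_def to_ac_sum sum_distrib_right)
    finally show "\<rho> = (\<Sum>\<rho>'\<in>R. to_ac (b \<rho> \<rho>') * \<rho>')" .
  qed (use \<gamma>(1) i in \<open>auto simp: R_def\<close>)
  thus False using \<gamma>(2) i by blast
qed

section \<open>Absolute values of a rational function field\<close>

lemma hom_to_fract_extend:
  fixes h :: "'r :: idom \<Rightarrow> 'b :: field"
  assumes h: "hom_on UNIV h" and inj: "\<And>x. h x = 0 \<Longrightarrow> x = 0"
  obtains H where "hom_on UNIV H" "\<And>x. H (to_fract x) = h x"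
proof -
  define H where "H z = (THE w. \<exists>a b. z = Fract a b \<and> b \<noteq> 0 \<and> w = h a / h b)" for z
  have H: "H (Fract a b) = h a / h b" if "b \<noteq> 0" for a b
    unfolding H_def
  proof (rule the_equality)
    fix w assume "\<exists>a' b'. Fract a b = Fract a' b' \<and> b' \<noteq> 0 \<and> w = h a' / h b'"
    then obtain a' b' where w: "Fract a b = Fract a' b'" "b' \<noteq> 0" "w = h a' / h b'" by blast
    hence "h (a * b') = h (a' * b)" using that by (simp add: eq_fract)
    hence "h a * h b' = h a' * h b" using hom_onD(3)[OF h] by simp
    moreover have "h b \<noteq> 0" "h b' \<noteq> 0" using that w inj by auto
    ultimately show "w = h a / h b" using w(3) by (simp add: frac_eq_eq)
  qed (use that in auto)
  note hh = hom_onD[OF h, simplified]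
  show ?thesis
  proof (rule that)
    show "H (to_fract x) = h x" for x by (simp add: to_fract_def H hh)
    have "H (x + y) = H x + H y" "H (x * y) = H x * H y" for x y
    proof -
      obtain a b where x: "x = Fract a b" "b \<noteq> 0" by (cases x)
      obtain c d where y: "y = Fract c d" "d \<noteq> 0" by (cases y)
      have "h b \<noteq> 0" "h d \<noteq> 0" using x y inj by auto
      thus "H (x + y) = H x + H y" "H (x * y) = H x * H y"
        using x y by (auto simp: H hh field_simps)
    qed
    moreover have "H 1 = 1" by (simp add: One_fract_def H hh)
    ultimately show "hom_on UNIV H" by (auto simp: hom_on_def)
  qed
qed

lemma nonarchimedean_fract_extend:
  fixes w :: "'r :: idom \<Rightarrow> real"
  assumes w: "\<And>x. 0 \<le> w x" "\<And>x. w x = 0 \<longleftrightarrow> x = 0" "\<And>x y. w (x * y) = w x * w y"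
    and ultra: "\<And>x y. w (x + y) \<le> max (w x) (w y)"
  obtains v where "nonarchimedean v" "\<And>x. v (to_fract x) = w x"
proof -
  define v where "v z = (THE u. \<exists>a b. z = Fract a b \<and> b \<noteq> 0 \<and> u = w a / w b)" for z
  have v: "v (Fract a b) = w a / w b" if "b \<noteq> 0" for a b
    unfolding v_def
  proof (rule the_equality)
    fix u assume "\<exists>a' b'. Fract a b = Fract a' b' \<and> b' \<noteq> 0 \<and> u = w a' / w b'"
    then obtain a' b' where u: "Fract a b = Fract a' b'" "b' \<noteq> 0" "u = w a' / w b'" by blast
    hence "w (a * b') = w (a' * b)" using that by (simp add: eq_fract)
    hence "w a * w b' = w a' * w b" using w(3) by simp
    moreover have "w b \<noteq> 0" "w b' \<noteq> 0" using that u w(2) by auto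
    ultimately show "u = w a / w b" using u(3) by (simp add: frac_eq_eq)
  qed (use that in auto)
  have one: "w 1 = 1" using w(2)[of 1] w(3)[of 1 1] by simp
  show ?thesis
  proof (rule that)
    show "v (to_fract x) = w x" for x by (simp add: to_fract_def v one)
    have v0: "v x \<ge> 0" "v x = 0 \<longleftrightarrow> x = 0" for x
    proof -
      obtain a b where x: "x = Fract a b" "b \<noteq> 0" by (cases x)
      thus "v x \<ge> 0" "v x = 0 \<longleftrightarrow> x = 0"
        using w by (auto simp: v Zero_fract_def eq_fract)
    qed
    have vxy: "v (x + y) \<le> max (v x) (v y)" "v (x * y) = v x * v y" for x y
    proof -
      obtain a b where x: "x = Fract a b" "b \<noteq> 0" by (cases x)
      obtain c d where y: "y = Fract c d" "d \<noteq> 0" by (cases y)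
      have pos: "w b > 0" "w d > 0" using x y w by (auto simp: less_le)
      show "v (x * y) = v x * v y" using x y by (auto simp: v w)
      have "v (x + y) = w (a * d + c * b) / (w b * w d)" using x y by (simp add: v w(3))
      also have "\<dots> \<le> max (w (a * d)) (w (c * b)) / (w b * w d)"
        using ultra pos by (intro divide_right_mono) auto
      also have "\<dots> = max (v x) (v y)"
        using pos x y by (simp add: v w(3) max_def field_simps)
      finally show "v (x + y) \<le> max (v x) (v y)" .
    qed
    have "v (x + y) \<le> v x + v y" for x y
      using vxy(1)[of x y] v0(1)[of x] v0(1)[of y] by linarith
    thus "nonarchimedean v"
      unfolding nonarchimedean_def absolute_value_def using v0 vxy by blast
  qed
qed

lemma map_poly_to_ac_hom:
  shows "map_poly to_ac (p + q) = map_poly to_ac p + map_poly to_ac q"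
    "map_poly to_ac (p * q) = map_poly to_ac p * map_poly to_ac q"
    "map_poly to_ac (p - q) = map_poly to_ac p - map_poly to_ac q"
  using hom_onD[OF map_poly_hom_UNIV[OF hom_to_ac]] hom_on_diff[OF _ map_poly_hom_UNIV[OF hom_to_ac]]
  by simp_all

lemma map_poly_to_ac_eq_0 [simp]: "map_poly to_ac p = 0 \<longleftrightarrow> p = 0"
  by (rule map_poly_eq_0_iff) auto

text \<open>
  The absolute value is given by the vanishing order at \<open>c\<close>. Up to equivalence it is that of the prime
  polynomial with the root \<open>c\<close>; parametrizing by roots avoids factorization into primes.
\<close>

lemma absolute_value_at_point:
  fixes c :: "'q :: field alg_closure"
  obtains v where "nonarchimedean v" "\<And>x. v (to_fract x) \<le> 1"
    "\<And>x. v (to_fract x) < 1 \<longleftrightarrow> poly (map_poly to_ac x) c = 0"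
proof -
  let ?m = "map_poly to_ac :: 'q poly \<Rightarrow> _"
  define w :: "'q poly \<Rightarrow> real" where "w x = (if x = 0 then 0 else (1/2) ^ order c (?m x))" for x
  have "w (x + y) \<le> max (w x) (w y)" for x y
  proof (cases "x = 0 \<or> y = 0 \<or> x + y = 0")
    case False
    let ?k = "min (order c (?m x)) (order c (?m y))"
    have "[:- c, 1:] ^ ?k dvd ?m x" "[:- c, 1:] ^ ?k dvd ?m y"
      by (auto intro: dvd_trans[OF le_imp_power_dvd order_1])
    hence "[:- c, 1:] ^ ?k dvd ?m (x + y)" by (simp add: map_poly_to_ac_hom)
    hence "?k \<le> order c (?m (x + y))" using False by (subst (asm) order_divides) auto
    hence "w (x + y) \<le> (1/2) ^ ?k" using False by (simp add: w_def power_decreasing)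
    also have "\<dots> \<le> max (w x) (w y)" using False by (simp add: w_def min_def)
    finally show ?thesis .
  qed (auto simp: w_def le_max_iff_disj)
  moreover have "w (x * y) = w x * w y" for x y
    by (auto simp: w_def map_poly_to_ac_hom order_mult power_add)
  moreover have "0 \<le> w x" "w x = 0 \<longleftrightarrow> x = 0" for x by (auto simp: w_def)
  ultimately obtain v where v: "nonarchimedean v" "\<And>x. v (to_fract x) = w x"
    using nonarchimedean_fract_extend[of w] by blast
  show ?thesis
  proof (rule that[OF v(1)])
    show "v (to_fract x) \<le> 1" for x by (auto simp: v w_def power_le_one)
    show "v (to_fract x) < 1 \<longleftrightarrow> poly (?m x) c = 0" for x
      by (cases "order c (?m x)") (auto simp: v w_def order_root intro: le_less_trans[OF power_le_one])
  qed
qed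

lemma absolute_value_at_infinity:
  obtains v :: "'q :: field poly fract \<Rightarrow> real"
  where "nonarchimedean v" "\<And>x. x \<noteq> 0 \<Longrightarrow> v (to_fract x) = 2 ^ degree x"
proof -
  define w :: "'q poly \<Rightarrow> real" where "w x = (if x = 0 then 0 else 2 ^ degree x)" for x
  have "w (x + y) \<le> max (w x) (w y)" for x y
  proof (cases "x = 0 \<or> y = 0 \<or> x + y = 0")
    case False
    have "(2::real) ^ degree (x + y) \<le> 2 ^ max (degree x) (degree y)"
      by (intro power_increasing degree_add_le_max) auto
    thus ?thesis using False by (auto simp: w_def max_def split: if_splits)
  qed (auto simp: w_def le_max_iff_disj)
  moreover have "w (x * y) = w x * w y" for x y
    by (auto simp: w_def degree_mult_eq power_add)
  moreover have "0 \<le> w x" "w x = 0 \<longleftrightarrow> x = 0" for x by (auto simp: w_def)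
  ultimately obtain v where "nonarchimedean v" "\<And>x. v (to_fract x) = w x"
    using nonarchimedean_fract_extend[of w] by blast
  thus ?thesis by (intro that[of v]) (auto simp: w_def)
qed

lemma prime_CHAR_fract_poly: "prime CHAR('q :: {field, finite} poly fract)"
proof (rule prime_CHAR_semidom)
  have "CHAR('q) > 0" by (rule finite_imp_CHAR_pos) simp
  moreover have "of_nat CHAR('q) = (0 :: 'q poly fract)"
  proof -
    have "of_nat m = to_fract (of_nat m :: 'q poly)" for m by (induction m) auto
    thus ?thesis by (metis of_nat_CHAR semiring_char_poly to_fract_0)
  qed
  ultimately show "CHAR('q poly fract) > 0"
    using CHAR_pos_iff by blast
qed

section \<open>Equidistributed solutions of bounded degree\<close>

text \<open>
  A generator of the ideal, that is a nonzero element of least degree, divides all \<open>a\<^sub>j\<close>; a root of it would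
  be a common root, so it is constant.
\<close>

lemma bezout_of_no_common_root:
  fixes a :: "'i \<Rightarrow> 'q :: field poly"
  assumes "finite J" and no_root: "\<And>c. \<exists>j\<in>J. poly (map_poly to_ac (a j)) c \<noteq> 0"
  obtains y where "(\<Sum>j\<in>J. y j * a j) = 1"
proof -
  define I where "I = {f. \<exists>y. f = (\<Sum>j\<in>J. y j * a j)}"
  have I_diff: "f - g \<in> I" if "f \<in> I" "g \<in> I" for f g
  proof -
    obtain y z where "f = (\<Sum>j\<in>J. y j * a j)" "g = (\<Sum>j\<in>J. z j * a j)" using \<open>f \<in> I\<close> \<open>g \<in> I\<close> by (auto simp: I_def)
    hence "f - g = (\<Sum>j\<in>J. (y j - z j) * a j)" by (simp add: algebra_simps sum_subtractf)
    thus ?thesis unfolding I_def mem_Collect_eq by (rule exI[of _ "\<lambda>j. y j - z j"])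
  qed
  have I_mult: "h * f \<in> I" if "f \<in> I" for f h
  proof -
    obtain y where "f = (\<Sum>j\<in>J. y j * a j)" using \<open>f \<in> I\<close> by (auto simp: I_def)
    hence "h * f = (\<Sum>j\<in>J. (h * y j) * a j)" by (simp add: sum_distrib_left mult.assoc)
    thus ?thesis unfolding I_def mem_Collect_eq by (rule exI[of _ "\<lambda>j. h * y j"])
  qed
  have aI: "a j \<in> I" if "j \<in> J" for j
  proof -
    have "(\<Sum>i\<in>J. (if i = j then 1 else 0) * a i) = (\<Sum>i\<in>J. if i = j then a i else 0)"
      by (intro sum.cong) auto
    also have "\<dots> = a j" using \<open>j \<in> J\<close> \<open>finite J\<close> by (subst sum.delta) auto
    finally have "a j = (\<Sum>i\<in>J. (if i = j then 1 else 0) * a i)" by (rule sym)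
    thus ?thesis unfolding I_def mem_Collect_eq by (rule exI[of _ "\<lambda>i. if i = j then 1 else 0"])
  qed
  obtain j1 where "j1 \<in> J" "poly (map_poly to_ac (a j1)) 0 \<noteq> 0" using no_root[of 0] by blast
  hence "a j1 \<in> I \<and> a j1 \<noteq> 0" using aI by auto
  then obtain g where g: "g \<in> I" "g \<noteq> 0" and min: "\<And>f. f \<in> I \<Longrightarrow> f \<noteq> 0 \<Longrightarrow> degree g \<le> degree f"
    using ex_has_least_nat[of "\<lambda>f. f \<in> I \<and> f \<noteq> 0" _ degree] by blast
  have "g dvd a j" if "j \<in> J" for j
  proof -
    have "a j - (a j div g) * g \<in> I" using aI[OF that] g(1) I_diff I_mult by blast
    hence "a j mod g \<in> I" by (simp add: minus_div_mult_eq_mod)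
    hence "a j mod g = 0" using min[of "a j mod g"] degree_mod_less[OF g(2), of "a j"] by force
    thus ?thesis by auto
  qed
  have "degree g = 0"
  proof (rule ccontr)
    assume "degree g \<noteq> 0"
    then obtain c where "poly (map_poly to_ac g) c = 0"
      using alg_closed_imp_poly_has_root[of "map_poly to_ac g"] by auto
    hence "poly (map_poly to_ac (a j)) c = 0" if "j \<in> J" for j
      using \<open>j \<in> J \<Longrightarrow> g dvd a j\<close>[OF that] by (auto simp: map_poly_to_ac_hom elim!: dvdE)
    thus False using no_root by blast
  qed
  then obtain u where u: "g = [:u:]" "u \<noteq> 0" using g(2) by (auto elim!: degree_eq_zeroE)
  hence "1 \<in> I" using I_mult[OF g(1), of "[:inverse u:]"] by (simp add: one_pCons)
  then obtain y where "1 = (\<Sum>j\<in>J. y j * a j)" by (auto simp: I_def)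
  thus ?thesis using that by metis
qed

text \<open>
  Modulo \<open>a\<^sub>o\<close>, the coefficient of largest degree, every other unknown can be made of degree at
  most \<open>D\<close>; the equation then bounds the degree of \<open>a\<^sub>o x\<^sub>o\<close> by \<open>2 D\<close>, and so that of \<open>x\<^sub>o\<close> by \<open>D\<close>.
\<close>

lemma bounded_degree_solution:
  fixes a :: "'i \<Rightarrow> 'q :: field poly"
  assumes J: "finite J" "o' \<in> J" and deg: "\<And>j. j \<in> J \<Longrightarrow> degree (a j) \<le> D"
    and o: "a o' \<noteq> 0" "degree (a o') = D" and y: "(\<Sum>j\<in>J. y j * a j) = 1"
    and b: "degree b \<le> D + D"
  obtains x where "(\<Sum>j\<in>J. a j * x j) = b" "\<And>j. j \<in> J \<Longrightarrow> degree (x j) \<le> D"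
proof -
  define J' where "J' = J - {o'}"
  define z where "z j = y j * b" for j
  define x where "x j = (if j = o' then z o' + (\<Sum>i\<in>J'. a i * (z i div a o')) else z j mod a o')" for j
  have split: "(\<Sum>j\<in>J. f j) = f o' + (\<Sum>j\<in>J'. f j)" for f :: "'i \<Rightarrow> 'q poly"
    using J by (simp add: J'_def sum.remove)
  have x': "x j = z j mod a o'" if "j \<in> J'" for j using that by (auto simp: x_def J'_def)
  have div_mod: "a j * (z j mod a o') + a o' * (a j * (z j div a o')) = a j * z j" for j
    by (metis add.commute distrib_left mult.left_commute mult_div_mod_eq)
  have "(\<Sum>j\<in>J. a j * x j) =
      a o' * z o' + (\<Sum>j\<in>J'. a j * (z j mod a o') + a o' * (a j * (z j div a o')))"
    by (simp add: split x' sum.distrib) (simp add: x_def distrib_left sum_distrib_left)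
  also have "\<dots> = (\<Sum>j\<in>J. a j * z j)" by (simp only: div_mod split)
  also have "\<dots> = (\<Sum>j\<in>J. y j * a j * b)" by (simp add: z_def mult_ac)
  also have "\<dots> = (\<Sum>j\<in>J. y j * a j) * b" by (simp add: sum_distrib_right)
  finally have sum: "(\<Sum>j\<in>J. a j * x j) = b" using y by simp
  have small: "degree (x j) \<le> D" if "j \<in> J'" for j
    using degree_mod_less[OF o(1), of "z j"] o(2) x'[OF that] by auto
  have "a o' * x o' = b - (\<Sum>j\<in>J'. a j * x j)" using sum by (simp add: split algebra_simps)
  moreover have "degree (\<Sum>j\<in>J'. a j * x j) \<le> D + D"
    using deg small J 
    by (intro degree_sum_le) (auto simp: J'_def intro!: order_trans[OF degree_mult_le] add_mono)
  ultimately have "degree (a o' * x o') \<le> D + D" using b by (metis degree_diff_le)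
  hence "degree (x o') \<le> D" using o by (cases "x o' = 0") (auto simp: degree_mult_eq)
  thus ?thesis using small sum by (intro that[of x]) (auto simp: J'_def)
qed

lemma finite_polys_degree_le: "finite {p :: 'q :: {finite, zero} poly. degree p \<le> D}"
proof -
  have "coeff p \<in> {f. \<forall>i. (i \<in> {..D} \<longrightarrow> f i \<in> UNIV) \<and> (i \<notin> {..D} \<longrightarrow> f i = 0)}"
    if "degree p \<le> D" for p :: "'q poly"
    using that by (auto intro: coeff_eq_0)
  hence "coeff ` {p :: 'q poly. degree p \<le> D} \<subseteq> {f. \<forall>i. (i \<in> {..D} \<longrightarrow> f i \<in> UNIV) \<and> (i \<notin> {..D} \<longrightarrow> f i = 0)}"
    by blast
  moreover have "finite {f :: nat \<Rightarrow> 'q. \<forall>i. (i \<in> {..D} \<longrightarrow> f i \<in> UNIV) \<and> (i \<notin> {..D} \<longrightarrow> f i = 0)}"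
    by (rule finite_set_of_finite_funs) auto
  ultimately show ?thesis
    by (meson finite_imageD finite_subset inj_on_subset coeff_inject injI subset_UNIV)
qed

text \<open>
  The solutions of degree at most \<open>D\<close> form a finite group. A surjective coordinate homomorphism has
  fibres of equal size over all its values, so any two coordinates differ by a permutation \<open>g i\<close> of
  the solutions.
\<close>

theorem equidistributed_solutions:
  fixes a :: "nat \<Rightarrow> 'q :: {field, finite} poly"
  assumes n: "n > 0" and surj: "\<And>i w. i < n \<Longrightarrow> degree w \<le> D \<Longrightarrow>
    \<exists>x. (\<forall>j<n. degree (x j) \<le> D) \<and> x i = w \<and> (\<Sum>j<n. a j * x j) = 0"
  obtains V :: "(nat \<Rightarrow> 'q poly) set" and g
  where "finite V" "\<And>x. x \<in> V \<Longrightarrow> (\<Sum>j<n. a j * x j) = 0"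
    "\<And>i. i < n \<Longrightarrow> g i permutes V" "\<And>i x. i < n \<Longrightarrow> x \<in> V \<Longrightarrow> x i = g i x 0"
    "\<exists>x\<in>V. \<exists>x'\<in>V. x 0 \<noteq> x' 0"
proof -
  define W where "W = {w :: 'q poly. degree w \<le> D}"
  \<comment> \<open>The value \<open>0\<close> outside of \<open>{..<n}\<close> makes \<open>V\<close> finite.\<close>
  define V where "V = {x :: nat \<Rightarrow> 'q poly. (\<forall>j. (j \<in> {..<n} \<longrightarrow> x j \<in> W) \<and> (j \<notin> {..<n} \<longrightarrow> x j = 0)) \<and>
      (\<Sum>j<n. a j * x j) = 0}"
  have W: "finite W" unfolding W_def by (rule finite_polys_degree_le)
  have W_diff: "u - w \<in> W" "u + w \<in> W" if "u \<in> W" "w \<in> W" for u w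
    using that by (auto simp: W_def intro: degree_diff_le degree_add_le)
  have V: "finite V"
    unfolding V_def using finite_set_of_finite_funs[of "{..<n}" W 0] W by (auto intro: rev_finite_subset)
  have surjV: "\<exists>s\<in>V. s i = w" if iw: "i < n" "w \<in> W" for i w
  proof -
    obtain x where x: "\<forall>j<n. degree (x j) \<le> D" "x i = w" "(\<Sum>j<n. a j * x j) = 0"
      using surj[of i w] iw by (auto simp: W_def)
    thus ?thesis using iw
      by (intro bexI[of _ "\<lambda>j. if j < n then x j else 0"]) (auto simp: V_def W_def)
  qed
  have fibre: "card {x\<in>V. x i = w} = card {x\<in>V. x i = 0}" if iw: "i < n" "w \<in> W" for i w
  proof -
    obtain s where s: "s \<in> V" "s i = w" using surjV[OF iw] by blast
    have "bij_betw (\<lambda>x j. x j + s j) {x\<in>V. x i = 0} {x\<in>V. x i = w}"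
    proof (rule bij_betwI[where g = "\<lambda>x j. x j - s j"])
      show "(\<lambda>x j. x j + s j) \<in> {x\<in>V. x i = 0} \<rightarrow> {x\<in>V. x i = w}"
        using s W_diff by (auto simp: V_def distrib_left sum.distrib)
      show "(\<lambda>x j. x j - s j) \<in> {x\<in>V. x i = w} \<rightarrow> {x\<in>V. x i = 0}"
        using s W_diff by (auto simp: V_def right_diff_distrib sum_subtractf)
    qed auto
    thus ?thesis by (simp add: bij_betw_same_card)
  qed
  have total: "card V = card W * card {x\<in>V. x i = 0}" if i: "i < n" for i
  proof -
    have "(\<lambda>x. x i) ` V \<subseteq> W" using i by (auto simp: V_def)
    from sum.group[OF V W this, of "\<lambda>_. 1 :: nat"]
    have "card V = (\<Sum>w\<in>W. card {x\<in>V. x i = w})" by simp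
    thus ?thesis using fibre[OF i] by simp
  qed
  have "card W > 0" using W by (auto simp: card_gt_0_iff W_def intro!: exI[of _ 0])
  hence same: "card {x\<in>V. x i = w} = card {x\<in>V. x 0 = w}" if "i < n" for i w
  proof (cases "w \<in> W")
    case True
    have "card W * card {x\<in>V. x i = 0} = card W * card {x\<in>V. x 0 = 0}"
      by (rule trans[OF total[OF that, symmetric] total[OF n]])
    hence "card {x\<in>V. x i = 0} = card {x\<in>V. x 0 = 0}"
      using mult_left_cancel[of "card W"] \<open>card W > 0\<close> by blast
    thus ?thesis by (simp only: fibre[OF that True] fibre[OF n True])
  next
    case False
    hence "{x\<in>V. x i = w} = {}" "{x\<in>V. x 0 = w} = {}" using that n by (auto simp: V_def)
    thus ?thesis by (simp only:)
  qed
  have "\<exists>p. p permutes V \<and> (\<forall>x\<in>V. x i = p x 0)" if i: "i < n" for i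
  proof -
    have "image_mset (\<lambda>x. x i) (mset_set V) = image_mset (\<lambda>x. x 0) (mset_set V)"
    proof (rule multiset_eqI)
      fix w
      have "count (image_mset (\<lambda>x. x i) (mset_set V)) w = card {x\<in>V. x i = w}" for i
      proof -
        have "count (image_mset (\<lambda>x. x i) (mset_set V)) w = (\<Sum>x\<in>{x\<in>V. x i = w}. 1)"
          unfolding count_image_mset' using V by (intro sum.cong) auto
        thus ?thesis by simp
      qed
      thus "count (image_mset (\<lambda>x. x i) (mset_set V)) w = count (image_mset (\<lambda>x. x 0) (mset_set V)) w"
        using same[OF i] by simp
    qed
    from image_mset_eq_implies_permutes[OF V this] show ?thesis by metis
  qed
  then obtain g where g: "\<And>i. i < n \<Longrightarrow> g i permutes V" "\<And>i x. i < n \<Longrightarrow> x \<in> V \<Longrightarrow> x i = g i x 0" by metis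
  obtain s s' where "s \<in> V" "s 0 = 0" "s' \<in> V" "s' 0 = 1"
    using surjV[OF n, of 0] surjV[OF n, of 1] by (auto simp: W_def)
  hence nonconst: "\<exists>x\<in>V. \<exists>x'\<in>V. x 0 \<noteq> x' 0" by (intro bexI[of _ s] bexI[of _ s']) auto
  have "(\<Sum>j<n. a j * x j) = 0" if "x \<in> V" for x using that by (simp add: V_def)
  thus ?thesis by (rule that[OF V _ g nonconst])
qed

text \<open>
  The criteria at the places of the points \<open>c\<close>, together with coprimality, say that the \<open>a\<^sub>j\<close> with
  \<open>j \<noteq> i\<close> have no common root. The criterion at infinity says that the largest degree \<open>D\<close> is attained
  at some \<open>j \<noteq> i\<close>. These are the hypotheses for prescribing the \<open>i\<close>-th coordinate of a solution.
\<close>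

theorem solutions_of_criteria:
  fixes a :: "nat \<Rightarrow> 'q :: {field, finite} poly"
  assumes n: "n \<ge> 2" and cop: "coprime_tuple n a"
    and crit: "absolute_value_criteria n (\<lambda>i. to_fract (a i))"
  obtains V :: "(nat \<Rightarrow> 'q poly) set" and g
  where "finite V" "\<And>x. x \<in> V \<Longrightarrow> (\<Sum>j<n. a j * x j) = 0"
    "\<And>i. i < n \<Longrightarrow> g i permutes V" "\<And>i x. i < n \<Longrightarrow> x \<in> V \<Longrightarrow> x i = g i x 0"
    "\<exists>x\<in>V. \<exists>x'\<in>V. x 0 \<noteq> x' 0"
proof -
  let ?J = "\<lambda>i. {..<n} - {i}"
  have J: "finite (?J i)" "?J i \<noteq> {}" for i
  proof -
    have "(if i = 0 then 1 else 0) \<in> ?J i" using n by auto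
    thus "?J i \<noteq> {}" by blast
  qed auto
  have crit': "\<exists>j\<in>?J i. v (to_fract (a i)) \<le> v (to_fract (a j))" if "nonarchimedean v" "i < n" for v i
  proof -
    have "v (to_fract (a i)) \<le> (MAX j\<in>?J i. v (to_fract (a j)))"
      using crit that by (simp add: absolute_value_criteria_def)
    moreover have "(MAX j\<in>?J i. v (to_fract (a j))) \<in> (\<lambda>j. v (to_fract (a j))) ` ?J i"
      using J[of i] by (intro Max_in) auto
    ultimately show ?thesis by auto
  qed
  have no_root: "\<exists>j\<in>?J i. poly (map_poly to_ac (a j)) c \<noteq> 0" if i: "i < n" for i c
  proof (rule ccontr)
    assume "\<not> ?thesis"
    hence root: "poly (map_poly to_ac (a j)) c = 0" if "j \<in> ?J i" for j using that by blast
    obtain v where v: "nonarchimedean v" "\<And>x. v (to_fract x) < 1 \<longleftrightarrow> poly (map_poly to_ac x) c = 0"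
      using absolute_value_at_point[of c] by metis
    obtain j where "j \<in> ?J i" "v (to_fract (a i)) \<le> v (to_fract (a j))" using crit'[OF v(1) i] by blast
    hence "v (to_fract (a i)) < 1" using v(2)[of "a j"] root[of j] by auto
    hence "poly (map_poly to_ac (a j)) c = 0" if "j < n" for j
      using root[of j] v(2) that by (cases "j = i") auto
    moreover obtain y where "(\<Sum>j<n. y j * a j) = 1"
    proof -
      have "1 \<in> {\<Sum>i<n. c i * a i |c. True}" using cop by (simp only: coprime_tuple_def UNIV_I)
      thus ?thesis using that by auto
    qed
    moreover have "poly (map_poly to_ac (\<Sum>j<n. y j * a j)) c = (\<Sum>j<n. poly (map_poly to_ac (y j * a j)) c)"
      using hom_on_sum[OF subring_set_UNIV map_poly_hom_UNIV[OF hom_to_ac], of "{..<n}" "\<lambda>j. y j * a j"]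
      by (simp add: poly_sum)
    ultimately show False by (simp add: map_poly_to_ac_hom)
  qed
  define D where "D = Max ((\<lambda>i. degree (a i)) ` {..<n})"
  have deg: "degree (a i) \<le> D" if "i < n" for i unfolding D_def using that by (intro Max_ge) auto
  have top: "\<exists>j\<in>?J i. a j \<noteq> 0 \<and> degree (a j) = D" if i: "i < n" for i
  proof -
    obtain m where m: "m < n" "a m \<noteq> 0" "degree (a m) = D"
    proof -
      have "D \<in> (\<lambda>i. degree (a i)) ` {..<n}" unfolding D_def using n by (intro Max_in) (auto simp: lessThan_empty_iff)
      then obtain m where m: "m < n" "degree (a m) = D" by auto
      obtain j where "j \<in> ?J 0" "poly (map_poly to_ac (a j)) 0 \<noteq> 0" 
      proof -
        have "0 < n" using n by simp
        from no_root[OF this, of 0] show ?thesis using that by (elim bexE)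
      qed
      hence j: "j < n" "a j \<noteq> 0" by auto
      show ?thesis
        using that[of m] that[of j] m j deg[of j] by (cases "a m = 0"; cases "D = 0") auto
    qed
    obtain v :: "'q poly fract \<Rightarrow> real" where v: "nonarchimedean v" "\<And>x. x \<noteq> 0 \<Longrightarrow> v (to_fract x) = 2 ^ degree x"
      by (rule absolute_value_at_infinity) blast
    have v0: "v (to_fract 0) = 0" using v(1) absolute_valueD(5) by (auto simp: nonarchimedean_def)
    show ?thesis
    proof (cases "m = i")
      case True
      obtain j where j: "j \<in> ?J i" "v (to_fract (a i)) \<le> v (to_fract (a j))" using crit'[OF v(1) i] by blast
      have vi: "v (to_fract (a i)) = 2 ^ D" using v(2)[of "a i"] m True by simp
      have "a j \<noteq> 0"
      proof
        assume "a j = 0"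
        hence "(2::real) ^ D \<le> 0" using j v0 vi by simp
        moreover have "(2::real) ^ D > 0" by simp
        ultimately show False by linarith
      qed
      hence "(2::real) ^ D \<le> 2 ^ degree (a j)" using j vi v(2)[of "a j"] by simp
      hence "D \<le> degree (a j)" by simp
      thus ?thesis using j deg[of j] \<open>a j \<noteq> 0\<close> by (intro bexI[of _ j]) auto
    qed (use m in auto)
  qed
  have surj: "\<exists>x. (\<forall>j<n. degree (x j) \<le> D) \<and> x i = w \<and> (\<Sum>j<n. a j * x j) = 0"
    if i: "i < n" and w: "degree (w :: 'q poly) \<le> D" for i w
  proof -
    obtain j0 where j0: "j0 \<in> ?J i" "a j0 \<noteq> 0" "degree (a j0) = D" using top[OF i] by blast
    obtain y where y: "(\<Sum>j\<in>?J i. y j * a j) = 1"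
      using bezout_of_no_common_root[OF J(1) no_root[OF i]] by metis
    have "degree (- (a i * w)) \<le> D + D"
      using deg[OF i] w by (auto intro!: order_trans[OF degree_mult_le] add_mono)
    then obtain x where x: "(\<Sum>j\<in>?J i. a j * x j) = - (a i * w)" "\<And>j. j \<in> ?J i \<Longrightarrow> degree (x j) \<le> D"
      using bounded_degree_solution[OF J(1) j0(1) _ j0(2,3) y] deg by (metis DiffD1 lessThan_iff)
    have "(\<Sum>j<n. a j * (x(i := w)) j) = a i * w + (\<Sum>j\<in>?J i. a j * x j)"
      using i by (subst sum.remove[of _ i]) auto
    hence "(\<Sum>j<n. a j * (x(i := w)) j) = 0" using x(1) by simp
    thus "\<exists>x. (\<forall>j<n. degree (x j) \<le> D) \<and> x i = w \<and> (\<Sum>j<n. a j * x j) = 0"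
      using x(2) w by (intro exI[of _ "x(i := w)"]) auto
  qed
  have n': "n > 0" using n by simp
  show ?thesis
    by (rule equidistributed_solutions[OF n' surj], assumption, assumption, rule that, assumption+)
qed

section \<open>A polynomial with prescribed local behaviour\<close>

definition eval_at :: "'q :: field alg_closure \<Rightarrow> 'q poly \<Rightarrow> 'q alg_closure" where
  "eval_at c x = poly (map_poly to_ac x) c"

lemma hom_eval_at: "hom_on UNIV (eval_at c)"
  unfolding hom_on_def eval_at_def by (simp add: map_poly_to_ac_hom)

lemma eval_at_simps [simp]:
  "eval_at c 0 = 0" "eval_at c 1 = 1" "eval_at c (x + y) = eval_at c x + eval_at c y"
  "eval_at c (x - y) = eval_at c x - eval_at c y" "eval_at c (- x) = - eval_at c x"
  "eval_at c (x * y) = eval_at c x * eval_at c y" "eval_at c (x ^ n) = eval_at c x ^ n"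
  using hom_onD[OF hom_eval_at] hom_on_diff[OF _ hom_eval_at] hom_on_uminus[OF _ hom_eval_at]
    hom_on_power[OF _ hom_eval_at] hom_on_0[OF _ hom_eval_at] by simp_all

lemma eval_at_monom [simp]: "eval_at c (monom 1 n) = c ^ n"
  by (simp add: eval_at_def map_poly_monom poly_monom)

lemma eval_at_prod: "eval_at c (prod h A) = (\<Prod>i\<in>A. eval_at c (h i))"
  by (rule hom_on_prod[OF _ hom_eval_at]) auto

text \<open>
  The condition is made for the completion at \<open>c\<close>: modulo the maximal ideal, \<open>f\<close> has the \<open>j\<close>
  distinct simple roots \<open>c, c\<^sup>2, \<dots>, c\<^sup>j\<close> and the root \<open>0\<close> of multiplicity \<open>k - j\<close>. Its constant coefficient
  vanishes to first order at \<open>c\<close>, so that Eisenstein's criterion applies to the factor of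
  degree \<open>k - j\<close>. The powers of \<open>c\<close> are distinct because \<open>c\<close> is not a root of unity of small order.
\<close>

definition good_point :: "nat \<Rightarrow> nat \<Rightarrow> 'q :: field alg_closure \<Rightarrow> 'q poly poly \<Rightarrow> bool" where
  "good_point k j c f \<longleftrightarrow> c \<noteq> 0 \<and> (\<forall>r\<in>{1..k}. c ^ r \<noteq> 1) \<and>
     map_poly (eval_at c) f = monom 1 (k - j) * (\<Prod>i=1..j. [:- (c ^ i), 1:]) \<and>
     eval_at c (pderiv (coeff f 0)) \<noteq> 0"

lemma prod_linear_monic:
  fixes b :: "'i \<Rightarrow> 'r :: idom"
  assumes "finite I"
  shows "degree (\<Prod>i\<in>I. [:- b i, 1:]) = card I" "lead_coeff (\<Prod>i\<in>I. [:- b i, 1:]) = 1"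
proof -
  show "degree (\<Prod>i\<in>I. [:- b i, 1:]) = card I"
    using assms by (subst degree_prod_eq_sum_degree) auto
  show "lead_coeff (\<Prod>i\<in>I. [:- b i, 1:]) = 1"
    by (simp add: lead_coeff_prod)
qed

text \<open>
  For a single point, the product of an Eisenstein polynomial and linear factors does the job. The
  parameter \<open>P\<close> stands for a polynomial with a simple root at \<open>c\<close>.
\<close>

lemma model_polynomial:
  fixes P :: "'q :: field poly"
  assumes mk: "m < k" and c: "c \<noteq> 0" "\<forall>r\<in>{1..k}. c ^ r \<noteq> 1"
    and P: "eval_at c P = 0" "eval_at c (pderiv P) \<noteq> 0"
  defines "f \<equiv> (monom 1 (k - m) + [:P:]) * (\<Prod>i=1..m. [:- monom 1 i, 1:])"
  shows "good_point k m c f" "coeff f k = 1" "\<And>i. i > k \<Longrightarrow> coeff f i = 0"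
proof -
  let ?L = "\<Prod>i=1..m. [:- monom 1 i :: 'q poly, 1:]"
  let ?A = "monom 1 (k - m) + [:P:]"
  have degA: "degree ?A = k - m"
    using mk by (subst degree_add_eq_left) (auto simp: degree_monom_eq)
  have lcA: "lead_coeff ?A = 1"
    using mk degA by (simp add: coeff_pCons split: nat.split)
  have A0: "?A \<noteq> 0" using lcA by (metis leading_coeff_0_iff zero_neq_one)
  have deg: "degree f = k"
    using A0 degA mk prod_linear_monic[of "{1..m}" "\<lambda>i. monom 1 i :: 'q poly"]
    unfolding f_def by (subst degree_mult_eq) auto
  have "lead_coeff f = 1"
    using lcA prod_linear_monic[of "{1..m}" "\<lambda>i. monom 1 i :: 'q poly"] unfolding f_def
    by (subst lead_coeff_mult) auto
  thus "coeff f k = 1" using deg by simp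
  show "coeff f i = 0" if "i > k" for i using that deg by (simp add: coeff_eq_0)
  have hp: "hom_on UNIV (map_poly (eval_at c))" by (rule map_poly_hom_UNIV[OF hom_eval_at])
  have "map_poly (eval_at c) f = map_poly (eval_at c) ?A * map_poly (eval_at c) ?L"
    unfolding f_def by (rule hom_onD(3)[OF hp]) auto
  also have "map_poly (eval_at c) ?A = monom 1 (k - m)"
    using P by (simp add: hom_onD(2)[OF hp] map_poly_monom map_poly_pCons)
  also have "map_poly (eval_at c) ?L = (\<Prod>i=1..m. [:- (c ^ i), 1:])"
    by (simp add: hom_on_prod[OF _ hp] map_poly_pCons)
  finally have 1: "map_poly (eval_at c) f = monom 1 (k - m) * (\<Prod>i=1..m. [:- (c ^ i), 1:])" .
  define U where "U = (\<Prod>i=1..m. - monom 1 i :: 'q poly)"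
  have "coeff f 0 = poly f 0" by (simp add: poly_0_coeff_0)
  also have "\<dots> = P * U" using mk by (simp add: f_def U_def poly_prod poly_monom)
  finally have "eval_at c (pderiv (coeff f 0)) = eval_at c U * eval_at c (pderiv P)"
    using P by (simp add: pderiv_mult)
  moreover have "eval_at c U \<noteq> 0" using c by (simp add: U_def eval_at_prod)
  ultimately show "good_point k m c f" using 1 c P by (simp add: good_point_def)
qed

text \<open>
  The points \<open>c\<^sub>0, c\<^sub>1, \<dots>\<close> and the polynomial are constructed together. A \<open>p\<close>-th power has
  derivative \<open>0\<close>, so correcting the polynomial by a multiple of the \<open>p\<close>-th power of a polynomial
  vanishing at the earlier points changes neither the values of the coefficients at these points
  nor those of their derivatives.

  The next point \<open>d\<close> is chosen as a root of \<open>1 - S\<close>, where \<open>S = t T\<^sup>q\<close> and \<open>T\<close> vanishes at the earlier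
  points and at the roots of unity of order at most \<open>k\<close>. Then \<open>M = S\<^sup>q\<close> takes the value \<open>1\<close> at \<open>d\<close>, so
  that adding \<open>M\<close> times the difference puts the model polynomial in place there; \<open>d\<close> differs from the
  earlier points, and its powers are distinct, because \<open>T(d) \<noteq> 0\<close>; and the root is simple since the
  derivative of \<open>1 - S\<close> is \<open>- T\<^sup>q\<close>.
\<close>

lemma good_points_step:
  fixes f :: "'q :: {field, finite} poly poly" and T :: "'q poly"
  assumes mk: "m < k" and f: "coeff f k = 1" "\<And>i. i > k \<Longrightarrow> coeff f i = 0"
    and good: "\<And>j. j < m \<Longrightarrow> good_point k j (c j) f" "\<And>j. j < m \<Longrightarrow> eval_at (c j) T = 0"
    and T: "T \<noteq> 0" "\<And>c r. r \<in> {1..k} \<Longrightarrow> c ^ r = 1 \<Longrightarrow> eval_at c T = 0"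
  shows "\<exists>(f' :: 'q poly poly) T' c'. coeff f' k = 1 \<and> (\<forall>i>k. coeff f' i = 0) \<and>
    (\<forall>j<Suc m. good_point k j (c' j) f' \<and> eval_at (c' j) T' = 0) \<and>
    T' \<noteq> 0 \<and> (\<forall>c. \<forall>r\<in>{1..k}. c ^ r = 1 \<longrightarrow> eval_at c T' = 0)"
proof -
  define q where "q = CHAR('q)"
  have q: "q > 0" "of_nat q = (0 :: 'q)"
    unfolding q_def by (auto intro: finite_imp_CHAR_pos)
  \<comment> \<open>The exponent \<open>q\<close> is the characteristic.\<close>
  have pderiv_q: "pderiv (x ^ q) = 0" for x :: "'q poly"
    by (simp add: pderiv_power q)
  define S where "S = monom 1 1 * T ^ q"
  define P where "P = 1 - S"
  have S0: "S \<noteq> 0" and degS: "degree S > 0"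
    using T by (auto simp: S_def monom_eq_0_iff degree_mult_eq degree_monom_eq)
  have "degree (map_poly to_ac P) \<noteq> 0"
  proof
    assume "degree (map_poly to_ac P) = 0"
    hence "degree (1 - P) = 0" by (intro le_zero_eq[THEN iffD1] degree_diff_le) auto
    thus False using degS by (simp add: P_def)
  qed
  then obtain d where d: "eval_at d P = 0"
    using alg_closed_imp_poly_has_root[of "map_poly to_ac P"] by (auto simp: eval_at_def)
  hence Sd: "eval_at d S = 1" by (simp add: P_def)
  hence Td: "eval_at d T \<noteq> 0" and d0: "d \<noteq> 0" using q(1) by (auto simp: S_def zero_power)
  have dr: "\<forall>r\<in>{1..k}. d ^ r \<noteq> 1" using Td T(2) by blast
  have "pderiv P = - (T ^ q)"
    by (simp add: P_def S_def pderiv_diff pderiv_mult pderiv_q pderiv_monom)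
  hence "eval_at d (pderiv P) \<noteq> 0" using Td by simp
  note model = model_polynomial[OF mk d0 dr d this]
  define fm where "fm = (monom 1 (k - m) + [:P:]) * (\<Prod>i=1..m. [:- monom 1 i, 1:])"
  note model = model[folded fm_def]
  define M where "M = S ^ q"
  define f' where "f' = f + smult M (fm - f)"
  have M': "pderiv M = 0" by (simp add: M_def pderiv_q)
  have coeff': "coeff f' i = coeff f i + M * (coeff fm i - coeff f i)" for i
    by (simp add: f'_def)
  have map': "map_poly (eval_at c) f' = map_poly (eval_at c) f +
      smult (eval_at c M) (map_poly (eval_at c) fm - map_poly (eval_at c) f)" for c
    by (rule poly_eqI) (simp add: coeff_map_poly coeff')
  have deriv': "eval_at c (pderiv (coeff f' 0)) = eval_at c (pderiv (coeff f 0)) +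
      eval_at c M * (eval_at c (pderiv (coeff fm 0)) - eval_at c (pderiv (coeff f 0)))" for c
    by (simp add: coeff' pderiv_add pderiv_mult pderiv_diff M')
  define c' where "c' = c(m := d)"
  have "good_point k j (c' j) f'" if "j < Suc m" for j
  proof (cases "j = m")
    case True
    have "eval_at d M = 1" using Sd by (simp add: M_def)
    thus ?thesis
      using model(1) True by (simp add: good_point_def map' deriv' c'_def)
  next
    case False
    hence j: "j < m" using that by simp
    have "eval_at (c j) M = 0" using good(2)[OF j] q by (simp add: M_def S_def)
    thus ?thesis
      using good(1)[OF j] False by (simp add: good_point_def map' deriv' c'_def)
  qed
  moreover have "eval_at (c' j) (T * P) = 0" if "j < Suc m" for j
    using that good(2)[of j] d by (auto simp: c'_def less_Suc_eq)
  moreover have "T * P \<noteq> 0" using T degS by (auto simp: P_def)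
  moreover have "coeff f' k = 1" "\<forall>i>k. coeff f' i = 0" using f model(2,3) by (auto simp: coeff')
  ultimately show ?thesis using T(2)
    by (intro exI[of _ f'] exI[of _ "T * P"] exI[of _ c']) auto
qed

lemma polynomial_with_good_points:
  obtains f :: "'q :: {field, finite} poly poly" and c
  where "degree f = k" "lead_coeff f = 1" "\<And>j. j < k \<Longrightarrow> good_point k j (c j) f"
proof -
  have "\<exists>f T c. coeff f k = 1 \<and> (\<forall>i>k. coeff f i = 0) \<and>
    (\<forall>j<m. good_point k j (c j) f \<and> eval_at (c j) T = 0) \<and>
    (T :: 'q poly) \<noteq> 0 \<and> (\<forall>c. \<forall>r\<in>{1..k}. c ^ r = 1 \<longrightarrow> eval_at c T = 0)" if "m \<le> k" for m
    using that
  proof (induction m)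
    case 0
    let ?T = "\<Prod>r=1..k. monom 1 r - 1 :: 'q poly"
    have "monom 1 r - 1 \<noteq> (0 :: 'q poly)" if "r \<in> {1..k}" for r
    proof
      assume "monom 1 r - 1 = (0 :: 'q poly)"
      hence "degree (monom (1 :: 'q) r) = 0" by simp
      thus False using that by (simp add: degree_monom_eq)
    qed
    hence "?T \<noteq> 0" by simp
    moreover have "eval_at c ?T = 0" if "r \<in> {1..k}" "c ^ r = 1" for c :: "'q alg_closure" and r
      unfolding eval_at_prod using that by (intro prod_zero) auto
    ultimately show ?case
      by (intro exI[of _ "monom 1 k"] exI[of _ ?T]) auto
  next
    case (Suc m)
    then obtain f T c where IH: "coeff f k = 1" "\<forall>i>k. coeff f i = 0"
      "\<forall>j<m. good_point k j (c j) f \<and> eval_at (c j) T = 0" "(T :: 'q poly) \<noteq> 0" 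
      "\<forall>c. \<forall>r\<in>{1..k}. c ^ r = 1 \<longrightarrow> eval_at c T = 0"
      by auto
    show ?case
    proof (rule good_points_step[of m k f c T])
      show "eval_at c' T = 0" if "r \<in> {1..k}" "c' ^ r = 1" for c' r using IH(5) that by blast
    qed (use Suc.prems IH in auto)
  qed
  from this[of k] obtain f :: "'q poly poly" and c where f: "coeff f k = 1" "\<forall>i>k. coeff f i = 0"
    "\<forall>j<k. good_point k j (c j) f" by auto
  have "degree f = k" using f(1,2) by (intro antisym degree_le le_degree) auto
  thus ?thesis using that f by auto
qed

section \<open>Polynomials over power series\<close>

lemma poly_taylor_2:
  fixes f :: "'r :: idom poly"
  shows "\<exists>g. poly f (a + d) = poly f a + poly (pderiv f) a * d + d ^ 2 * g"
proof (induction f)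
  case (pCons u f)
  then obtain g where g: "poly f (a + d) = poly f a + poly (pderiv f) a * d + d ^ 2 * g" by blast
  have "poly (pCons u f) (a + d) = poly (pCons u f) a + poly (pderiv (pCons u f)) a * d
      + d ^ 2 * (poly (pderiv f) a + a * g + d * g)"
    by (simp add: g pderiv_pCons algebra_simps power2_eq_square)
  thus ?case by blast
qed simp

lemma hom_fps_nth_0: "hom_on UNIV (\<lambda>s :: 'f :: field fps. fps_nth s 0)"
  by (simp add: hom_on_def)

abbreviation residue :: "'f :: field fps poly \<Rightarrow> 'f poly" where
  "residue \<equiv> map_poly (\<lambda>s. fps_nth s 0)"

lemma residue_hom:
  "residue (p * q) = residue p * residue q" "residue (p - q) = residue p - residue q"
  "poly (residue p) (fps_nth x 0) = fps_nth (poly p x) 0"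
  using hom_onD(3)[OF map_poly_hom_UNIV[OF hom_fps_nth_0]]
    hom_on_diff[OF _ map_poly_hom_UNIV[OF hom_fps_nth_0]] poly_map_poly_hom[OF _ hom_fps_nth_0, of p x]
  by simp_all

lemma residue_pderiv: "residue (pderiv p) = pderiv (residue p)"
proof (rule poly_eqI)
  fix n
  have "fps_nth (of_nat m * s) 0 = of_nat m * fps_nth s 0" for m and s :: "'a fps"
    by (induction m) (auto simp: algebra_simps)
  thus "coeff (residue (pderiv p)) n = coeff (pderiv (residue p)) n"
    by (simp add: coeff_map_poly coeff_pderiv del: of_nat_Suc)
qed

lemma fps_power_dvd_iff: "fps_X ^ n dvd (s :: 'f :: field fps) \<longleftrightarrow> (\<forall>i<n. fps_nth s i = 0)"
proof
  assume "fps_X ^ n dvd s"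
  then obtain t where "s = fps_X ^ n * t" by (elim dvdE)
  thus "\<forall>i<n. fps_nth s i = 0" by (simp add: fps_X_power_mult_nth)
next
  assume "\<forall>i<n. fps_nth s i = 0"
  hence "s = fps_X ^ n * fps_shift n s"
    by (intro fps_ext) (auto simp: fps_X_power_mult_nth)
  thus "fps_X ^ n dvd s" by (rule dvdI)
qed

text \<open>
  Newton iteration: a change of the argument by \<open>u X\<^sup>N\<close> leaves the coefficients of the value below \<open>X\<^sup>N\<close>
  as they are, and changes that of \<open>X\<^sup>N\<close> by \<open>u\<close> times the nonzero residue of the derivative.
\<close>

theorem hensel_fps:
  fixes f :: "'f :: field fps poly"
  assumes root: "poly (residue f) b = 0" and simple: "poly (pderiv (residue f)) b \<noteq> 0"
  obtains s where "poly f s = 0" "fps_nth s 0 = b"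
proof -
  define D where "D = poly (pderiv (residue f)) b"
  define s :: "nat \<Rightarrow> 'f fps" where "s = rec_nat (fps_const b)
     (\<lambda>N t. t + fps_const (- fps_nth (poly f t) (Suc N) / D) * fps_X ^ Suc N)"
  have s_0: "s 0 = fps_const b"
    and s_Suc: "s (Suc N) = s N + fps_const (- fps_nth (poly f (s N)) (Suc N) / D) * fps_X ^ Suc N" for N
    by (simp_all add: s_def)
  have s_nth_0: "fps_nth (s N) 0 = b" for N
    by (induction N) (simp_all add: s_0 s_Suc fps_X_power_mult_right_nth del: power_Suc)
  have deriv: "fps_nth (poly (pderiv f) (s N)) 0 = D" for N
    using residue_hom(3)[of "pderiv f" "s N"] by (simp add: s_nth_0 D_def residue_pderiv)
  have vanish: "\<forall>i\<le>N. fps_nth (poly f (s N)) i = 0" for N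
  proof (induction N)
    case 0
    show ?case using residue_hom(3)[of f "s 0"] root by (simp add: s_nth_0)
  next
    case (Suc N)
    define u where "u = - fps_nth (poly f (s N)) (Suc N) / D"
    define d where "d = fps_const u * fps_X ^ Suc N"
    have sd: "s (Suc N) = s N + d" by (simp only: s_Suc d_def u_def)
    obtain g where g: "poly f (s N + d) = poly f (s N) + poly (pderiv f) (s N) * d + d ^ 2 * g"
      using poly_taylor_2 by blast
    have t1: "fps_nth (poly (pderiv f) (s N) * d) i = (if i < Suc N then 0 else u * fps_nth (poly (pderiv f) (s N)) (i - Suc N))" for i
    proof -
      have eq: "poly (pderiv f) (s N) * d = fps_const u * (poly (pderiv f) (s N) * fps_X ^ Suc N)"
        by (simp only: d_def mult_ac)
      show ?thesis unfolding eq by (simp add: fps_X_power_mult_right_nth del: power_Suc)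
    qed
    have "fps_X ^ Suc (Suc N) dvd d ^ 2"
      unfolding d_def power_mult_distrib power_mult[symmetric]
      by (intro dvd_mult le_imp_power_dvd) auto
    hence t2: "fps_nth (d ^ 2 * g) i = 0" if "i \<le> Suc N" for i
      using that fps_power_dvd_iff[of "Suc (Suc N)" "d ^ 2 * g"] by (auto simp: dvd_mult2)
    show ?case
    proof (intro allI impI)
      fix i assume i: "i \<le> Suc N"
      show "fps_nth (poly f (s (Suc N))) i = 0"
      proof (cases "i = Suc N")
        case True
        thus ?thesis using simple by (simp add: sd g t1 t2 deriv u_def D_def)
      next
        case False
        thus ?thesis using i Suc by (simp add: sd g t1 t2)
      qed
    qed
  qed
  define S where "S = Abs_fps (\<lambda>N. fps_nth (s N) N)"
  have stable: "fps_nth (s (N + m)) i = fps_nth (s N) i" if "i \<le> N" for N m i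
    using that by (induction m) (simp_all add: s_Suc fps_X_power_mult_right_nth del: power_Suc)
  have "fps_nth (poly f S) N = 0" for N
  proof -
    define d where "d = S - s N"
    have "fps_nth d i = 0" if "i \<le> N" for i
      using stable[of i i "N - i"] that by (simp add: d_def S_def)
    hence d: "fps_X ^ Suc N dvd d" by (simp add: fps_power_dvd_iff del: power_Suc)
    obtain g where "poly f (s N + d) = poly f (s N) + poly (pderiv f) (s N) * d + d ^ 2 * g"
      using poly_taylor_2 by blast
    hence "poly f S - poly f (s N) = d * (poly (pderiv f) (s N) + d * g)"
      by (simp add: d_def algebra_simps power2_eq_square)
    hence "fps_X ^ Suc N dvd poly f S - poly f (s N)" using d by simp
    hence "fps_nth (poly f S - poly f (s N)) N = 0" by (subst (asm) fps_power_dvd_iff) blast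
    thus ?thesis using vanish[of N] by simp
  qed
  hence "poly f S = 0" by (intro fps_ext) simp
  moreover have "fps_nth S 0 = b" by (simp add: S_def s_nth_0)
  ultimately show ?thesis using that by blast
qed

text \<open>
  Modulo \<open>X\<close> the polynomial is a power of the variable, so in a nontrivial factorization both factors
  would have constant coefficients divisible by \<open>X\<close>, and that of \<open>E\<close> would be divisible by \<open>X\<^sup>2\<close>.
\<close>

theorem eisenstein_fps:
  fixes E :: "'f :: field fps poly"
  assumes monic: "lead_coeff E = 1" and deg: "degree E = e" "e > 0"
    and res: "residue E = monom 1 e" and E0: "fps_nth (coeff E 0) 1 \<noteq> 0"
  shows "irreducible E"
proof (rule irreducibleI)
  show "E \<noteq> 0" using monic by auto
  show "\<not> is_unit E" using deg by (auto simp: is_unit_poly_iff)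
  fix A B assume E: "E = A * B"
  have "lead_coeff A * lead_coeff B = 1" using monic by (simp add: E lead_coeff_mult)
  hence units: "is_unit (lead_coeff A)" "is_unit (lead_coeff B)" 
    by (metis dvd_triv_left, metis dvd_triv_right)
  have deg_res: "degree (residue P) = degree P" if "is_unit (lead_coeff P)" for P :: "'f fps poly"
    using that by (intro map_poly_degree_eq) (auto simp: fps_is_unit_iff)
  have res_AB: "residue A * residue B = monom 1 e" using res by (simp add: E residue_hom)
  have unit: "is_unit P" if "is_unit (lead_coeff P)" "degree P = 0" for P :: "'f fps poly"
    using that by (auto elim!: degree_eq_zeroE simp: is_unit_const_poly_iff)
  have "degree A = 0 \<or> degree B = 0"
  proof (rule ccontr)
    assume neg: "\<not> (degree A = 0 \<or> degree B = 0)"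
    have nz: "residue A * residue B \<noteq> 0" unfolding res_AB by (simp add: monom_eq_0_iff)
    hence nz': "residue A \<noteq> 0" "residue B \<noteq> 0" by auto
    have sum: "degree (residue A) + degree (residue B) = e"
      using degree_mult_eq[OF nz'] unfolding res_AB by (simp add: degree_monom_eq)
    have "order 0 (monom (1 :: 'f) e) = e"
    proof -
      have "monom (1 :: 'f) e = [:- 0, 1:] ^ e" by (simp add: monom_altdef)
      thus ?thesis by (simp only: order_power_n_n)
    qed
    hence ord: "order 0 (residue A) + order 0 (residue B) = e"
      using order_mult[OF nz, of 0] by (simp add: res_AB)
    have le: "order 0 (residue A) \<le> degree (residue A)" "order 0 (residue B) \<le> degree (residue B)"
      using nz by (auto intro: order_degree)
    have "order 0 (residue A) \<noteq> 0" "order 0 (residue B) \<noteq> 0"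
      using sum ord le neg deg_res[OF units(1)] deg_res[OF units(2)] by linarith+
    hence "coeff (residue A) 0 = 0" "coeff (residue B) 0 = 0"
      using order_root[of "residue A" 0] order_root[of "residue B" 0] nz'
      by (simp_all only: poly_0_coeff_0) auto
    hence "fps_nth (coeff A 0) 0 = 0" "fps_nth (coeff B 0) 0 = 0" by (simp_all add: coeff_map_poly)
    hence "fps_nth (coeff E 0) 1 = 0" by (simp add: E coeff_mult_0)
    thus False using E0 by simp
  qed
  thus "is_unit A \<or> is_unit B" using unit units by blast
qed

instance fps :: (field) semiring_gcd_mult_normalize ..

text \<open>
  By Gauss's lemma, irreducibility passes to the field of fractions, the field of Laurent series.
\<close>

lemma eisenstein_fps_fract:
  fixes E :: "'f :: field fps poly"
  assumes "lead_coeff E = 1" "degree E = e" "e > 0" "residue E = monom 1 e" "fps_nth (coeff E 0) 1 \<noteq> 0"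
  shows "irreducible (map_poly to_fract E)"
  using eisenstein_fps[OF assms] nonconst_poly_irreducible_iff[of E] assms(2,3) by auto

lemma prod_linear_dvd:
  fixes f :: "'r :: idom poly"
  assumes "finite I" "inj_on \<alpha> I" "\<And>i. i \<in> I \<Longrightarrow> poly f (\<alpha> i) = 0"
  shows "(\<Prod>i\<in>I. [:- \<alpha> i, 1:]) dvd f"
  using assms
proof (induction I arbitrary: f rule: finite_induct)
  case (insert i I)
  obtain g where g: "f = [:- \<alpha> i, 1:] * g"
    using insert.prems(2)[of i] by (auto simp: poly_eq_0_iff_dvd elim!: dvdE)
  have "poly g (\<alpha> i') = 0" if "i' \<in> I" for i'
  proof -
    have "\<alpha> i' \<noteq> \<alpha> i" using insert.prems(1) insert.hyps that by (auto simp: inj_on_def)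
    thus ?thesis using insert.prems(2)[of i'] that by (simp add: g)
  qed
  hence "(\<Prod>i\<in>I. [:- \<alpha> i, 1:]) dvd g" using insert by (auto simp: inj_on_def)
  hence "[:- \<alpha> i, 1:] * (\<Prod>i\<in>I. [:- \<alpha> i, 1:]) dvd f" unfolding g by (intro mult_dvd_mono dvd_refl)
  thus ?case using insert.hyps by (simp only: prod.insert[OF insert.hyps] simp_thms)
qed auto

text \<open>
  The simple roots \<open>b i\<close> of the residue polynomial lift to power series; what remains after dividing
  by them is an Eisenstein polynomial.
\<close>

theorem local_factorization:
  fixes f :: "'f :: field fps poly"
  assumes monic: "lead_coeff f = 1" "degree f = e + card I" and e: "e > 0"
    and I: "finite I" "inj_on b I" "\<And>i. i \<in> I \<Longrightarrow> b i \<noteq> 0"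
    and res: "residue f = monom 1 e * (\<Prod>i\<in>I. [:- b i, 1:])" and f0: "fps_nth (coeff f 0) 1 \<noteq> 0"
  obtains E \<alpha> where "f = E * (\<Prod>i\<in>I. [:- \<alpha> i, 1:])" "irreducible (map_poly to_fract E)" "degree E > 0"
    "inj_on \<alpha> I" "\<And>i. i \<in> I \<Longrightarrow> poly E (\<alpha> i) \<noteq> 0"
proof -
  have "\<exists>s. poly f s = 0 \<and> fps_nth s 0 = b i" if i: "i \<in> I" for i
  proof (rule hensel_fps)
    define g where "g = monom 1 e * (\<Prod>j\<in>I - {i}. [:- b j, 1:])"
    have split: "residue f = [:- b i, 1:] * g"
      using I i unfolding res g_def by (subst prod.remove[of I i]) (auto simp: mult_ac)
    show "poly (residue f) (b i) = 0" unfolding split by simp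
    have "poly g (b i) \<noteq> 0"
      using I i by (auto simp: g_def poly_monom poly_prod inj_on_def)
    moreover have "poly (pderiv ([:- b i, 1:] * g)) (b i) = poly g (b i)"
      by (simp only: pderiv_mult) (simp add: pderiv_pCons)
    ultimately show "poly (pderiv (residue f)) (b i) \<noteq> 0" unfolding split by simp
  qed blast
  then obtain \<alpha> where \<alpha>: "\<And>i. i \<in> I \<Longrightarrow> poly f (\<alpha> i) = 0" "\<And>i. i \<in> I \<Longrightarrow> fps_nth (\<alpha> i) 0 = b i" by metis
  have inj: "inj_on \<alpha> I" using I(2) \<alpha>(2) by (metis inj_on_def)
  define L where "L = (\<Prod>i\<in>I. [:- \<alpha> i, 1:])"
  obtain E where E: "f = E * L"
    using prod_linear_dvd[OF I(1) inj \<alpha>(1)] unfolding L_def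
    by (metis dvdE mult.commute)
  note L = prod_linear_monic[OF I(1), of \<alpha>, folded L_def]
  have lcE: "lead_coeff E = 1" using monic L by (simp add: E lead_coeff_mult)
  have "E \<noteq> 0" "L \<noteq> 0" using lcE L by auto
  hence degE: "degree E = e" using monic L by (simp add: E degree_mult_eq)
  have "residue L = (\<Prod>i\<in>I. [:- b i, 1:])"
    unfolding L_def using \<alpha>(2)
    by (subst hom_on_prod[OF _ map_poly_hom_UNIV[OF hom_fps_nth_0]])
       (auto simp: map_poly_pCons intro!: prod.cong)
  moreover have "(\<Prod>i\<in>I. [:- b i, 1:]) \<noteq> 0" using I(1) by simp
  ultimately have resE: "residue E = monom 1 e" using res by (simp add: E residue_hom)
  hence "fps_nth (coeff E 0) 0 = 0" using e
    by (metis (mono_tags, lifting) coeff_map_poly coeff_monom fps_zero_nth less_numeral_extra(3))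
  hence "fps_nth (coeff E 0) 1 \<noteq> 0" using f0 by (auto simp: E coeff_mult_0)
  hence irr: "irreducible (map_poly to_fract E)" using eisenstein_fps_fract[OF lcE degE e resE] by blast
  have "poly E (\<alpha> i) \<noteq> 0" if "i \<in> I" for i
  proof
    assume "poly E (\<alpha> i) = 0"
    hence "poly (residue E) (b i) = 0" using residue_hom(3)[of E "\<alpha> i"] \<alpha>(2)[OF that] by simp
    thus False using I(3)[OF that] by (simp add: resE poly_monom)
  qed
  thus ?thesis using that[of E \<alpha>] E irr degE e inj by (simp add: L_def)
qed

section \<open>An extension with the full symmetric group\<close>

text \<open>
  Since \<open>p\<close> splits into linear factors, so does its image, with the images of the roots.
\<close>

lemma hom_image_of_roots:
  fixes p :: "'a :: alg_closed_field poly" and h :: "'a \<Rightarrow> 'b :: field"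
  assumes h: "hom_on UNIV h" and p: "p \<noteq> 0" and w: "poly (map_poly h p) w = 0"
  obtains z where "poly p z = 0" "h z = w"
proof -
  have "\<exists>z. poly p z = 0 \<and> h z = w"
    using p w
  proof (induction "degree p" arbitrary: p)
    case 0
    then obtain u where "p = [:u:]" "u \<noteq> 0" by (auto elim: degree_eq_zeroE)
    thus ?case using 0 injD[OF hom_inj[OF h], of u 0] hom_on_0[OF _ h] by (auto simp: map_poly_pCons)
  next
    case (Suc n)
    obtain z where z: "poly p z = 0" using alg_closed_imp_poly_has_root[of p] Suc by auto
    then obtain q where q: "p = [:- z, 1:] * q" by (auto simp: poly_eq_0_iff_dvd elim!: dvdE)
    have q0: "q \<noteq> 0" using Suc.prems(1) by (auto simp: q)
    hence deg: "degree p = Suc (degree q)" unfolding q by (subst degree_mult_eq) auto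
    have "map_poly h p = map_poly h [:- z, 1:] * map_poly h q"
      unfolding q by (rule hom_onD(3)[OF map_poly_hom_UNIV[OF h]]) auto
    also have "map_poly h [:- z, 1:] = [:- h z, 1:]"
      using hom_onD(1)[OF h] hom_on_uminus[OF _ h] hom_on_0[OF _ h] by (simp add: map_poly_pCons)
    finally have "h z = w \<or> poly (map_poly h q) w = 0" using Suc.prems by auto
    thus ?case
    proof
      assume "poly (map_poly h q) w = 0"
      then obtain z' where "poly q z' = 0" "h z' = w" 
        using Suc.hyps(1)[of q] Suc.hyps(2) q0 deg by auto
      thus ?case by (auto simp: q)
    qed (use z in blast)
  qed
  thus ?thesis using that by blast
qed

lemma subring_set_vimage: "hom_on UNIV h \<Longrightarrow> subring_set T \<Longrightarrow> subring_set (h -` T)"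
  using hom_onD[of UNIV h] hom_on_diff[of UNIV h] by (simp add: subring_set_def)

text \<open>Expansion at \<open>c\<close>, by the substitution \<open>t = c + X\<close>.\<close>

definition local_embedding :: "'q :: field alg_closure \<Rightarrow> 'q poly \<Rightarrow> 'q alg_closure fps" where
  "local_embedding c x = fps_of_poly (pcompose (map_poly to_ac x) [:c, 1:])"

lemma hom_local_embedding: "hom_on UNIV (local_embedding c)"
  unfolding hom_on_def local_embedding_def
  by (simp add: map_poly_to_ac_hom pcompose_add pcompose_mult fps_of_poly_add fps_of_poly_mult pcompose_1)

lemma local_embedding_eq_0: "local_embedding c x = 0 \<Longrightarrow> x = 0"
  unfolding local_embedding_def
  by (metis fps_of_poly_0 fps_of_poly_eq_iff map_poly_to_ac_eq_0 pcompose_eq_0 degree_pCons_eq_if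
      one_neq_zero pCons_eq_0_iff zero_less_one One_nat_def degree_0)

lemma local_embedding_nth_0: "fps_nth (local_embedding c x) 0 = eval_at c x"
  by (simp add: local_embedding_def eval_at_def flip: poly_0_coeff_0) (simp add: poly_pcompose)

lemma local_embedding_nth_1: "fps_nth (local_embedding c x) 1 = eval_at c (pderiv x)"
proof -
  let ?p = "map_poly to_ac x"
  have "pderiv ?p = map_poly to_ac (pderiv x)"
    by (rule poly_eqI) (simp add: coeff_map_poly coeff_pderiv del: of_nat_Suc)
  moreover have "coeff (pcompose ?p [:c, 1:]) 1 = poly (pderiv (pcompose ?p [:c, 1:])) 0"
    by (simp add: poly_0_coeff_0 coeff_pderiv)
  ultimately show ?thesis
    by (simp add: local_embedding_def eval_at_def pderiv_pcompose poly_pcompose pderiv_pCons)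
qed

lemma map_poly_compose_0: "g 0 = 0 \<Longrightarrow> h 0 = 0 \<Longrightarrow> map_poly g (map_poly h p) = map_poly (\<lambda>x. g (h x)) p"
  by (rule poly_eqI) (simp add: coeff_map_poly)

definition root_set :: "'q :: field poly poly \<Rightarrow> 'q poly fract alg_closure set" where
  "root_set f = {z. poly (map_poly to_ac (map_poly to_fract f)) z = 0}"

text \<open>
  Let \<open>\<theta>\<close> be an embedding of the algebraic closure of the rational function field into that of the
  field of Laurent series at the point. The ring \<open>S\<close> of elements which \<open>\<theta>\<close> maps to Laurent series
  contains the \<open>j\<close> simple roots; any polynomial over \<open>S\<close> with one of the other roots becomes a multiple
  of the irreducible Eisenstein factor, so that it has all of them. Hence these roots are conjugate
  over \<open>S\<close>.
\<close>

theorem transitive_on_remaining_roots: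
  fixes f :: "'q :: field poly poly"
  assumes f: "lead_coeff f = 1" "degree f = k" and jk: "j < k" and good: "good_point k j c f"
  obtains A where "A \<subseteq> root_set f" "card A = j" "root_set f - A \<noteq> {}"
    "\<And>\<beta> \<beta>'. \<beta> \<in> root_set f - A \<Longrightarrow> \<beta>' \<in> root_set f - A \<Longrightarrow>
       \<exists>\<sigma>. automorphism \<sigma> \<and> (\<forall>x\<in>A. \<sigma> x = x) \<and> \<sigma> \<beta> = \<beta>'"
proof -
  let ?\<iota> = "local_embedding c"
  let ?t = "to_fract :: 'q alg_closure fps \<Rightarrow> _"
  note \<iota> = hom_local_embedding[of c]
  have \<iota>0: "?\<iota> 0 = 0" using hom_on_0[OF _ \<iota>] by simp
  define F where "F = map_poly ?\<iota> f"
  have degF: "degree F = k" unfolding F_def using local_embedding_eq_0[of c] f(2)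
    by (subst degree_map_poly) auto
  have lcF: "lead_coeff F = 1" using degF f hom_onD(1)[OF \<iota>] \<iota>0 by (simp add: F_def coeff_map_poly)
  have resF: "residue F = monom 1 (k - j) * (\<Prod>i\<in>{1..j}. [:- (c ^ i), 1:])"
  proof -
    have "residue F = map_poly (eval_at c) f"
      by (rule poly_eqI) (simp add: F_def coeff_map_poly \<iota>0 local_embedding_nth_0)
    thus ?thesis using good by (simp add: good_point_def)
  qed
  have F0: "fps_nth (coeff F 0) 1 \<noteq> 0"
    using good local_embedding_nth_1[of c "coeff f 0"] by (simp add: F_def coeff_map_poly \<iota>0 good_point_def)
  have c0: "c \<noteq> 0" using good by (simp add: good_point_def)
  have "inj_on (\<lambda>i. c ^ i) {1..j}"
  proof (rule linorder_inj_onI)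
    fix a b :: nat assume ab: "a < b" "a \<in> {1..j}" "b \<in> {1..j}"
    have "c ^ b = c ^ a * c ^ (b - a)" using ab by (simp flip: power_add)
    moreover have "b - a \<in> {1..k}" using ab jk by auto
    hence "c ^ (b - a) \<noteq> 1" using good unfolding good_point_def by blast
    ultimately show "c ^ a \<noteq> c ^ b" using c0 by simp
  qed auto
  then obtain E \<alpha> where E: "F = E * (\<Prod>i\<in>{1..j}. [:- \<alpha> i, 1:])" "irreducible (map_poly ?t E)"
    "degree E > 0" "inj_on \<alpha> {1..j}" "\<And>i. i \<in> {1..j} \<Longrightarrow> poly E (\<alpha> i) \<noteq> 0"
    using local_factorization[of F "k - j" "{1..j}" "\<lambda>i. c ^ i"] lcF degF jk c0 resF F0 by auto

  obtain H where H: "hom_on UNIV H" "\<And>x. H (to_fract x) = ?t (?\<iota> x)"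
    using hom_to_fract_extend[OF hom_on_compose[OF \<iota> _ hom_to_fract]] local_embedding_eq_0[of c]
    by auto
  have "hom_on (range to_ac) (to_ac \<circ> H \<circ> of_ac)"
    using hom_onD[OF H(1)] by (auto simp: hom_on_def simp flip: to_ac_add to_ac_mult)
  then obtain \<theta> where \<theta>: "hom_on UNIV \<theta>" and "\<And>x. x \<in> range to_ac \<Longrightarrow> \<theta> x = (to_ac \<circ> H \<circ> of_ac) x"
    using extend_hom_to_closure[OF subring_range_to_ac order_refl] by metis
  hence \<theta>_base: "\<theta> (to_ac x) = to_ac (H x)" for x by simp
  have \<theta>0: "\<theta> 0 = 0" using hom_on_0[OF _ \<theta>] by simp
  define f' where "f' = map_poly to_ac (map_poly to_fract f)"
  have f'0: "f' \<noteq> 0" using f by (auto simp: f'_def)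
  let ?u = "\<lambda>s. to_ac (?t s)"
  have u: "hom_on UNIV ?u" using hom_on_compose[OF hom_to_fract _ hom_to_ac] by (simp add: o_def)
  have map_u: "map_poly ?u p = map_poly to_ac (map_poly ?t p)" for p
    by (rule map_poly_compose_0[symmetric]) auto
  have \<theta>f: "map_poly \<theta> f' = map_poly ?u F"
    by (rule poly_eqI) (simp add: f'_def F_def coeff_map_poly \<theta>0 \<theta>_base H(2) \<iota>0)
  have factor: "map_poly ?u F = map_poly ?u E * (\<Prod>i\<in>{1..j}. [:- ?u (\<alpha> i), 1:])"
  proof -
    have "map_poly ?u (\<Prod>i\<in>{1..j}. [:- \<alpha> i, 1:]) = (\<Prod>i\<in>{1..j}. [:- ?u (\<alpha> i), 1:])"
      by (subst hom_on_prod[OF _ map_poly_hom_UNIV[OF u]]) (auto simp: map_poly_pCons)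
    thus ?thesis using hom_onD(3)[OF map_poly_hom_UNIV[OF u], of E] by (simp add: E(1))
  qed
  have root_iff: "z \<in> root_set f \<longleftrightarrow> poly (map_poly ?u E) (\<theta> z) = 0 \<or> (\<exists>i\<in>{1..j}. \<theta> z = ?u (\<alpha> i))" for z
  proof -
    have "z \<in> root_set f \<longleftrightarrow> \<theta> (poly f' z) = 0"
      using hom_inj[OF \<theta>] \<theta>0 by (auto simp: root_set_def f'_def dest: injD[where y = 0])
    also have "\<dots> \<longleftrightarrow> poly (map_poly ?u F) (\<theta> z) = 0"
      using poly_map_poly_hom[OF _ \<theta>, of f' z] by (simp add: \<theta>f)
    also have "\<dots> \<longleftrightarrow> poly (map_poly ?u E) (\<theta> z) = 0 \<or> (\<exists>i\<in>{1..j}. \<theta> z = ?u (\<alpha> i))"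
      by (simp add: factor poly_prod)
    finally show ?thesis .
  qed
  have lift: "\<exists>z\<in>root_set f. \<theta> z = w" if w: "poly (map_poly ?u F) w = 0" for w
  proof -
    obtain z where "poly f' z = 0" "\<theta> z = w"
      by (rule hom_image_of_roots[OF \<theta> f'0, of w]) (use w in \<open>simp add: \<theta>f\<close>)
    thus ?thesis by (auto simp: root_set_def f'_def)
  qed
  have "\<exists>z\<in>root_set f. \<theta> z = ?u (\<alpha> i)" if "i \<in> {1..j}" for i
    using that by (intro lift) (auto simp: factor poly_prod)
  then obtain a where a: "\<And>i. i \<in> {1..j} \<Longrightarrow> a i \<in> root_set f" "\<And>i. i \<in> {1..j} \<Longrightarrow> \<theta> (a i) = ?u (\<alpha> i)" by metis
  define A where "A = a ` {1..j}"
  have u_inj: "?u s = ?u s' \<longleftrightarrow> s = s'" for s s' by simp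
  have "inj_on a {1..j}"
    using E(4) a(2) unfolding inj_on_def by (metis u_inj)
  hence cardA: "card A = j" by (simp add: A_def card_image)
  have other: "z \<in> root_set f - A \<longleftrightarrow> poly (map_poly ?u E) (\<theta> z) = 0" for z
  proof -
    have E_root: "poly (map_poly ?u E) (?u (\<alpha> i)) \<noteq> 0" if "i \<in> {1..j}" for i
      using poly_map_poly_hom[OF _ u, of E "\<alpha> i"] E(5)[OF that] by simp
    have A_iff: "z \<in> A \<longleftrightarrow> (\<exists>i\<in>{1..j}. \<theta> z = ?u (\<alpha> i))"
    proof
      show "\<exists>i\<in>{1..j}. \<theta> z = ?u (\<alpha> i)" if "z \<in> A" using that a(2) unfolding A_def by blast
      assume "\<exists>i\<in>{1..j}. \<theta> z = ?u (\<alpha> i)"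
      then obtain i where i: "i \<in> {1..j}" "\<theta> z = \<theta> (a i)" using a(2) by auto
      hence "z = a i" using injD[OF hom_inj[OF \<theta>]] by blast
      thus "z \<in> A" using i(1) by (simp add: A_def)
    qed
    show ?thesis
    proof (cases "z \<in> A")
      case True
      then obtain i where "i \<in> {1..j}" "\<theta> z = ?u (\<alpha> i)" unfolding A_iff by (elim bexE)
      hence "poly (map_poly ?u E) (\<theta> z) \<noteq> 0" using E_root by (simp only: not_False_eq_True)
      thus ?thesis using True by blast
    next
      case False
      thus ?thesis using root_iff[of z] A_iff by blast
    qed
  qed
  have "root_set f - A \<noteq> {}"
  proof -
    have "degree (map_poly ?u E) = degree E" by (rule degree_map_poly) auto
    then obtain w where w: "poly (map_poly ?u E) w = 0"
      using alg_closed_imp_poly_has_root[of "map_poly ?u E"] E(3) by auto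
    then obtain z where "z \<in> root_set f" "\<theta> z = w" using lift[of w] by (auto simp: factor)
    thus ?thesis using other[of z] w by auto
  qed
  moreover have "\<exists>\<sigma>. automorphism \<sigma> \<and> (\<forall>x\<in>A. \<sigma> x = x) \<and> \<sigma> \<beta> = \<beta>'"
    if \<beta>: "\<beta> \<in> root_set f - A" "\<beta>' \<in> root_set f - A" for \<beta> \<beta>'
  proof -
    define S where "S = \<theta> -` range to_ac"
    have S: "subring_set S"
      unfolding S_def by (rule subring_set_vimage[OF \<theta> subring_range_to_ac])
    have S2: "range to_ac \<subseteq> S" by (auto simp: S_def \<theta>_base)
    have AS: "A \<subseteq> S" using a(2) by (auto simp: A_def S_def)
    obtain m where m: "minpoly_over S \<beta> m" by (rule minpoly_over_exists[OF S2])
    have \<theta>m: "map_poly \<theta> m \<in> polys_over (range to_ac)"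
      using m by (auto simp: minpoly_over_def polys_over_def coeff_map_poly \<theta>0 S_def)
    have "poly (map_poly \<theta> m) (\<theta> \<beta>) = 0"
      using poly_map_poly_hom[OF _ \<theta>, of m \<beta>] m \<theta>0 by (simp add: minpoly_over_def)
    moreover have "poly (map_poly to_ac (map_poly ?t E)) (\<theta> \<beta>) = 0" using other \<beta>(1) by (simp add: map_u)
    ultimately obtain q where "map_poly \<theta> m = map_poly to_ac (map_poly ?t E) * q"
      using minpoly_over_dvd[OF subring_range_to_ac _ irreducible_minpoly[OF E(2)] \<theta>m]
      by (metis inverse_in_intermediate_ring[OF subring_range_to_ac order_refl])
    hence "poly (map_poly \<theta> m) (\<theta> \<beta>') = 0" using other \<beta>(2) by (simp add: map_u)
    hence "\<theta> (poly m \<beta>') = 0" using poly_map_poly_hom[OF _ \<theta>, of m \<beta>'] by simp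
    hence "poly m \<beta>' = 0" using hom_inj[OF \<theta>] \<theta>0 by (metis injD)
    then obtain \<sigma> where "automorphism \<sigma>" "\<And>x. x \<in> S \<Longrightarrow> \<sigma> x = x" "\<sigma> \<beta> = \<beta>'"
      using automorphism_transitive[OF S S2 m] by metis
    thus ?thesis using AS by blast
  qed
  moreover have "A \<subseteq> root_set f" using a(1) by (auto simp: A_def)
  ultimately show ?thesis using that cardA by blast
qed

lemma automorphism_root_set: "automorphism \<sigma> \<Longrightarrow> \<sigma> z \<in> root_set f \<longleftrightarrow> z \<in> root_set f"
proof -
  assume \<sigma>: "automorphism \<sigma>"
  have "inv_into UNIV \<sigma> (\<sigma> z) = z" using automorphism_bij[OF \<sigma>] by (simp add: bij_is_inj)
  thus ?thesis
    using automorphism_root[OF \<sigma>, of "map_poly to_fract f" z]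
      automorphism_root[OF automorphism_inv[OF \<sigma>], of "map_poly to_fract f" "\<sigma> z"]
    by (auto simp: root_set_def)
qed

text \<open>
  A group acting such that for every \<open>j\<close> some set of \<open>j\<close> points has a pointwise stabilizer which is
  transitive on the other points is the full symmetric group: a partial permutation is extended one
  point at a time.
\<close>

theorem automorphism_extending_injection:
  assumes fin: "finite (root_set f)"
    and trans: "\<And>j. j < card (root_set f) \<Longrightarrow> \<exists>A\<subseteq>root_set f. card A = j \<and>
      (\<forall>\<beta>\<in>root_set f - A. \<forall>\<beta>'\<in>root_set f - A. \<exists>\<sigma>. automorphism \<sigma> \<and> (\<forall>x\<in>A. \<sigma> x = x) \<and> \<sigma> \<beta> = \<beta>')"
    and B: "B \<subseteq> root_set f" "inj_on \<pi> B" "\<pi> ` B \<subseteq> root_set f"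
  shows "\<exists>\<sigma>. automorphism \<sigma> \<and> (\<forall>x\<in>B. \<sigma> x = \<pi> x)"
proof -
  define Z where "Z = root_set f"
  have "finite B" using B(1) fin by (rule finite_subset)
  thus ?thesis using B
  proof (induction B arbitrary: \<pi> rule: finite_induct)
    case empty
    have "automorphism (\<lambda>x. x)" by (simp add: automorphism_def hom_on_def)
    thus ?case by auto
  next
    case (insert b B)
    have "card (insert b B) \<le> card Z"
      using insert.prems(1) fin unfolding Z_def by (intro card_mono) auto
    hence "card B < card Z" using insert.hyps by simp
    then obtain A where A: "A \<subseteq> Z" "card A = card B"
      "\<And>\<beta> \<beta>'. \<beta> \<in> Z - A \<Longrightarrow> \<beta>' \<in> Z - A \<Longrightarrow> \<exists>\<sigma>. automorphism \<sigma> \<and> (\<forall>x\<in>A. \<sigma> x = x) \<and> \<sigma> \<beta> = \<beta>'"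
      using trans unfolding Z_def by metis
    have "finite A" using A(1) fin unfolding Z_def by (rule finite_subset)
    then obtain \<phi> where \<phi>: "bij_betw \<phi> B A"
      using A(2) insert.hyps(1) by (metis finite_same_card_bij)
    obtain \<tau> where \<tau>: "automorphism \<tau>" "\<And>x. x \<in> B \<Longrightarrow> \<tau> x = \<phi> x"
      using insert.IH[of \<phi>] insert.prems(1) \<phi> A(1) unfolding Z_def bij_betw_def by auto
    obtain \<sigma> where \<sigma>: "automorphism \<sigma>" "\<And>x. x \<in> B \<Longrightarrow> \<sigma> x = \<pi> x"
      using insert.IH[of \<pi>] insert.prems by (auto simp: inj_on_insert)
    have bij: "bij \<tau>" "bij \<sigma>" using \<tau>(1) \<sigma>(1) by (auto intro: automorphism_bij)
    define b' where "b' = inv_into UNIV \<sigma> (\<pi> b)"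
    have \<sigma>b': "\<sigma> b' = \<pi> b" using bij(2) by (simp add: b'_def bij_is_surj surj_f_inv_f)
    have b'Z: "b' \<in> Z"
      using automorphism_root_set[OF \<sigma>(1), of b' f] insert.prems(3) by (simp add: \<sigma>b' Z_def)
    have b'B: "b' \<notin> B"
    proof
      assume "b' \<in> B"
      hence "\<pi> b' = \<pi> b" using \<sigma>(2) \<sigma>b' by metis
      thus False using \<open>b' \<in> B\<close> insert.prems(2) insert.hyps(2) by (metis inj_onD insert_iff)
    qed
    have outside: "\<tau> x \<in> Z - A" if x: "x \<in> Z" "x \<notin> B" for x
    proof -
      have "\<tau> x \<notin> \<phi> ` B"
      proof
        assume "\<tau> x \<in> \<phi> ` B"
        then obtain y where "y \<in> B" "\<tau> x = \<tau> y" using \<tau>(2) by auto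
        thus False using x(2) bij(1) by (metis bij_is_inj injD)
      qed
      moreover have "\<phi> ` B = A" using \<phi> by (simp add: bij_betw_def)
      ultimately show ?thesis using automorphism_root_set[OF \<tau>(1), of x f] x(1) by (simp add: Z_def)
    qed
    obtain \<kappa> where \<kappa>: "automorphism \<kappa>" "\<And>x. x \<in> A \<Longrightarrow> \<kappa> x = x" "\<kappa> (\<tau> b) = \<tau> b'"
      using A(3)[of "\<tau> b" "\<tau> b'"] outside[of b] outside[of b'] b'Z b'B insert.hyps insert.prems(1)
      unfolding Z_def by auto
    let ?\<rho> = "\<sigma> \<circ> inv_into UNIV \<tau> \<circ> \<kappa> \<circ> \<tau>"
    have \<tau>_inv: "inv_into UNIV \<tau> (\<tau> x) = x" for x using bij(1) by (simp add: bij_is_inj)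
    have "?\<rho> x = \<pi> x" if "x \<in> insert b B" for x
    proof (cases "x = b")
      case True
      thus ?thesis by (simp add: \<kappa> \<tau>_inv \<sigma>b')
    next
      case False
      hence x: "x \<in> B" using that by simp
      hence "\<tau> x \<in> A" using \<tau>(2) \<phi> by (auto simp: bij_betw_def)
      thus ?thesis using x by (simp add: \<kappa>(2) \<tau>_inv \<sigma>(2))
    qed
    moreover have "automorphism ?\<rho>"
      by (intro automorphism_compose automorphism_inv \<sigma>(1) \<tau>(1) \<kappa>(1))
    ultimately show ?case by blast
  qed
qed

text \<open>
  The good points for \<open>j < k\<close> supply the stabilizers. The point for \<open>j = k - 1\<close> also shows that the
  polynomial has \<open>k\<close> distinct roots: there are \<open>k - 1\<close> simple ones and at least one other.
\<close>

theorem symmetric_group_realization: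
  assumes "k > 0"
  obtains Z :: "'q :: {field, finite} poly fract alg_closure set"
  where "finite Z" "card Z = k"
    "\<And>\<pi>. inj_on \<pi> Z \<Longrightarrow> \<pi> ` Z \<subseteq> Z \<Longrightarrow> \<exists>\<sigma>. automorphism \<sigma> \<and> (\<forall>x\<in>Z. \<sigma> x = \<pi> x)"
proof -
  obtain f :: "'q poly poly" and c where f: "degree f = k" "lead_coeff f = 1" 
    and good: "\<And>j. j < k \<Longrightarrow> good_point k j (c j) f"
    using polynomial_with_good_points[where k = k] by blast
  let ?Z = "root_set f"
  let ?f = "map_poly to_ac (map_poly to_fract f)"
  have deg: "degree ?f = k" "?f \<noteq> 0" using f by (auto simp: degree_map_poly)
  have fin: "finite ?Z" unfolding root_set_def using deg(2) by (rule poly_roots_finite)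
  have "card ?Z \<le> k" using card_poly_roots_bound[OF deg(2)] deg(1) by (simp add: root_set_def)
  moreover have "k \<le> card ?Z"
  proof -
    obtain A where A: "A \<subseteq> ?Z" "card A = k - 1" "?Z - A \<noteq> {}"
      using transitive_on_remaining_roots[OF f(2,1) _ good, of "k - 1"] assms by (metis diff_less zero_less_one)
    have "card A < card ?Z" using A fin by (intro psubset_card_mono) auto
    thus ?thesis using A(2) by simp
  qed
  ultimately have card: "card ?Z = k" by simp
  have trans: "\<exists>A\<subseteq>?Z. card A = j \<and>
      (\<forall>\<beta>\<in>?Z - A. \<forall>\<beta>'\<in>?Z - A. \<exists>\<sigma>. automorphism \<sigma> \<and> (\<forall>x\<in>A. \<sigma> x = x) \<and> \<sigma> \<beta> = \<beta>')" 
    if "j < card ?Z" for j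
    using transitive_on_remaining_roots[OF f(2,1) _ good, of j] that card by metis
  show ?thesis
    by (rule that[OF fin card]) (rule automorphism_extending_injection[OF fin trans], auto)
qed

section \<open>Linear Galois relations\<close>

text \<open>
  Index the roots \<open>r\<^sub>x\<close> of a polynomial with full symmetric group by the solutions \<open>x \<in> V\<close> and put
  \<open>\<gamma>\<^sub>i = \<Sum>\<^sub>x x\<^sub>i r\<^sub>x\<close>. The linear relation holds for each \<open>x\<close> separately, and the permutation \<open>g i\<close> turns
  \<open>\<gamma>\<^sub>0\<close> into \<open>\<gamma>\<^sub>i\<close>.
\<close>

theorem smyth_tuple_of_solutions:
  fixes a :: "nat \<Rightarrow> 'q :: {field, finite} poly" and V :: "(nat \<Rightarrow> 'q poly) set"
  assumes V: "finite V" and rel: "\<And>x. x \<in> V \<Longrightarrow> (\<Sum>i<n. a i * x i) = 0"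
    and g: "\<And>i. i < n \<Longrightarrow> g i permutes V" "\<And>i x. i < n \<Longrightarrow> x \<in> V \<Longrightarrow> x i = g i x 0"
    and nonconst: "\<exists>x\<in>V. \<exists>x'\<in>V. x 0 \<noteq> x' 0"
  shows "smyth_tuple n (\<lambda>i. to_fract (a i))"
proof -
  have "card V > 0" using V nonconst by (auto simp: card_gt_0_iff)
  then obtain Z :: "'q poly fract alg_closure set" where Z: "finite Z" "card Z = card V"
    and sym: "\<And>\<pi>. inj_on \<pi> Z \<Longrightarrow> \<pi> ` Z \<subseteq> Z \<Longrightarrow> \<exists>\<sigma>. automorphism \<sigma> \<and> (\<forall>x\<in>Z. \<sigma> x = \<pi> x)"
    using symmetric_group_realization by metis
  obtain r where r: "bij_betw r V Z" using finite_same_card_bij[OF V Z(1)] Z(2) by auto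
  have sym_V: "\<exists>\<sigma>. automorphism \<sigma> \<and> (\<forall>x\<in>V. \<sigma> (r x) = r (p x))" if p: "p permutes V" for p
  proof -
    let ?\<pi> = "r \<circ> p \<circ> inv_into V r"
    have "bij_betw ?\<pi> Z Z"
      using r p by (meson bij_betw_inv_into bij_betw_trans permutes_imp_bij)
    then obtain \<sigma> where "automorphism \<sigma>" "\<And>z. z \<in> Z \<Longrightarrow> \<sigma> z = ?\<pi> z"
      using sym[of ?\<pi>] by (auto simp: bij_betw_def)
    moreover have "inv_into V r (r x) = x" "r x \<in> Z" if "x \<in> V" for x
      using r that by (auto simp: bij_betw_def)
    ultimately show ?thesis by (intro exI[of _ \<sigma>]) auto
  qed
  let ?e = "\<lambda>w :: 'q poly. to_ac (to_fract w)"
  have e: "hom_on UNIV ?e" using hom_on_compose[OF hom_to_fract _ hom_to_ac] by (simp add: o_def)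
  define \<gamma> where "\<gamma> i = (\<Sum>x\<in>V. ?e (x i) * r x)" for i
  have apply_aut: "\<sigma> (\<gamma> 0) = (\<Sum>x\<in>V. ?e (x 0) * \<sigma> (r x))" if "automorphism \<sigma>" for \<sigma>
  proof -
    have \<sigma>: "hom_on UNIV \<sigma>" "\<And>x. \<sigma> (to_ac x) = to_ac x" using that by (auto simp: automorphism_def)
    thus ?thesis unfolding \<gamma>_def
      by (subst hom_on_sum[OF _ \<sigma>(1)]) (auto simp: hom_onD(3)[OF \<sigma>(1)])
  qed
  have conj: "\<exists>\<sigma>. automorphism \<sigma> \<and> \<sigma> (\<gamma> 0) = \<gamma> i" if i: "i < n" for i
  proof -
    obtain \<sigma> where \<sigma>: "automorphism \<sigma>" "\<And>x. x \<in> V \<Longrightarrow> \<sigma> (r x) = r (inv_into UNIV (g i) x)"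
      using sym_V[OF permutes_inv[OF g(1)[OF i]]] by blast
    have "\<gamma> i = (\<Sum>x\<in>V. ?e (g i x 0) * r (inv_into UNIV (g i) (g i x)))"
      unfolding \<gamma>_def using g(2)[OF i] permutes_inverses(2)[OF g(1)[OF i]] by (intro sum.cong) auto
    also have "\<dots> = (\<Sum>x\<in>V. ?e (x 0) * r (inv_into UNIV (g i) x))"
      by (rule sum.permute[OF g(1)[OF i], unfolded o_def, symmetric])
    also have "\<dots> = \<sigma> (\<gamma> 0)" using \<sigma> by (simp add: apply_aut)
    finally show ?thesis using \<sigma>(1) by metis
  qed
  \<comment> \<open>If \<open>\<gamma>\<^sub>0\<close> were zero, its image under the transposition of \<open>x\<close> and \<open>y\<close> would be too; the difference
    of the two is \<open>(x\<^sub>0 - y\<^sub>0) (r\<^sub>x - r\<^sub>y)\<close>.\<close>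
  have nonzero: "\<gamma> 0 \<noteq> 0"
  proof
    assume 0: "\<gamma> 0 = 0"
    obtain x y where xy: "x \<in> V" "y \<in> V" "x 0 \<noteq> y 0" using nonconst by blast
    hence ne: "x \<noteq> y" by auto
    let ?s = "Transposition.transpose x y"
    obtain \<sigma> where \<sigma>: "automorphism \<sigma>" "\<And>z. z \<in> V \<Longrightarrow> \<sigma> (r z) = r (?s z)"
      using sym_V[OF permutes_swap_id[OF xy(1,2)]] by blast
    have "\<sigma> (\<gamma> 0) = 0" using \<sigma>(1) 0 hom_on_0[of UNIV \<sigma>] by (simp add: automorphism_def)
    hence "(\<Sum>z\<in>V. ?e (z 0) * r (?s z)) = 0" using \<sigma> by (simp add: apply_aut)
    hence "0 = (\<Sum>z\<in>V. ?e (z 0) * r z) - (\<Sum>z\<in>V. ?e (z 0) * r (?s z))" using 0 by (simp add: \<gamma>_def)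
    also have "\<dots> = (\<Sum>z\<in>V. ?e (z 0) * (r z - r (?s z)))" by (simp add: right_diff_distrib sum_subtractf)
    also have "\<dots> = (\<Sum>z\<in>{x, y}. ?e (z 0) * (r z - r (?s z)))"
      using V xy by (intro sum.mono_neutral_right) auto
    also have "\<dots> = (?e (x 0) - ?e (y 0)) * (r x - r y)" using ne by (simp add: algebra_simps)
    finally have "?e (x 0) = ?e (y 0) \<or> r x = r y" by simp
    thus False using xy r ne by (auto simp: bij_betw_def dest: inj_onD)
  qed
  have "galois_conjugates n \<gamma>"
  proof -
    obtain p :: "'q poly fract poly" where p: "irreducible p" "poly (map_poly to_ac p) (\<gamma> 0) = 0"
      by (rule irreducible_poly_of)
    have "poly (map_poly to_ac p) (\<gamma> i) = 0 \<and> \<gamma> i \<noteq> 0" if i: "i < n" for i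
    proof -
      obtain \<sigma> where \<sigma>: "automorphism \<sigma>" "\<sigma> (\<gamma> 0) = \<gamma> i" using conj[OF i] by blast
      have "\<gamma> i \<noteq> 0"
        using \<sigma> nonzero hom_inj[of \<sigma>] hom_on_0[of UNIV \<sigma>] unfolding automorphism_def by (metis injD subring_set_UNIV)
      thus ?thesis using automorphism_root[OF \<sigma>(1) p(2)] \<sigma>(2) by simp
    qed
    thus ?thesis using p(1) unfolding galois_conjugates_def by blast
  qed
  moreover have "(\<Sum>i<n. ?e (a i) * \<gamma> i) = 0"
  proof -
    have "(\<Sum>i<n. ?e (a i) * \<gamma> i) = (\<Sum>x\<in>V. \<Sum>i<n. ?e (a i * x i) * r x)"
      unfolding \<gamma>_def sum_distrib_left by (subst sum.swap) (simp add: mult_ac)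
    also have "\<dots> = (\<Sum>x\<in>V. ?e (\<Sum>i<n. a i * x i) * r x)"
      by (simp only: sum_distrib_right[symmetric] hom_on_sum[OF subring_set_UNIV e UNIV_I])
    also have "\<dots> = 0" using rel by simp
    finally show ?thesis .
  qed
  ultimately show ?thesis unfolding smyth_tuple_def by blast
qed

theorem theorem4p2:
  fixes a :: "nat \<Rightarrow> 'q :: {field, finite} poly" and n :: nat
  assumes "n \<ge> 3"
    and "coprime_tuple n a"
  shows "smyth_tuple n (\<lambda>i. to_fract (a i)) \<longleftrightarrow>
         absolute_value_criteria n (\<lambda>i. to_fract (a i))"
proof
  have n: "n \<ge> 2" using assms(1) by simp
  assume "smyth_tuple n (\<lambda>i. to_fract (a i))"
  thus "absolute_value_criteria n (\<lambda>i. to_fract (a i))"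
    using smyth_tuple_nonarchimedean[OF _ _ _ n] not_archimedean[OF prime_CHAR_fract_poly]
    unfolding absolute_value_criteria_def by blast
next
  have n: "n \<ge> 2" using assms(1) by simp
  assume crit: "absolute_value_criteria n (\<lambda>i. to_fract (a i))"
  show "smyth_tuple n (\<lambda>i. to_fract (a i))"
    by (rule solutions_of_criteria[OF n assms(2) crit]) (rule smyth_tuple_of_solutions)
qed

end
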